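(* Let $G$ be a connected Lie group with Lie algebra $L(G)$, let $\Gamma$ be a semigroup with identity $e$, and let $\rho:\Gamma\to\mathrm{End}(G)$ be an endomorphism action with $\rho(e)=\mathrm{Id}$. Define the induced action $\rho_e$ of $\Gamma$ on $L(G)$ by $\rho_e(\gamma)=d\rho(\gamma)|_e$. Then $(G,\rho)$ is expansive if and only if for every non-zero $v\in L(G)$ the orbit $\{\rho_e(\gamma)(v):\gamma\in\Gamma\}$ is an unbounded subset of $L(G)$.
   Context: $\mathrm{End}(G)$ denotes the semigroup (under composition) of continuous endomorphisms of $G$; an endomorphism action is a semigroup homomorphism $\rho:\Gamma\to\mathrm{End}(G)$. An endomorphism action $\rho$ of $\Gamma$ on a metrizable topological group $X$ is expansive if there is a neighborhood $U$ of the identity of $X$ with $\bigcap_{\gamma\in\Gamma}\rho(\gamma)^{-1}(U)=\{e\}$. Boundedness in $L(G)$ is with respect to any norm on this finite-dimensional real vector space. *)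

theory Defs
  imports "HOL-Analysis.Analysis" "HOL-Algebra.Group"
begin

fun iter_dd :: "'a::real_normed_vector list \<Rightarrow> ('a \<Rightarrow> 'b::real_normed_vector) \<Rightarrow> 'a \<Rightarrow> 'b" where
  "iter_dd [] f = f"
| "iter_dd (v # vs) f = (\<lambda>x. frechet_derivative (iter_dd vs f) (at x) v)"

definition smooth_on :: "'a::euclidean_space set \<Rightarrow> ('a \<Rightarrow> 'b::euclidean_space) \<Rightarrow> bool" where
  "smooth_on S f \<longleftrightarrow> open S \<and> (\<forall>vs. iter_dd vs f differentiable_on S)"

text \<open>A Lie group: a (Hausdorff, second countable -- imposed on the type) topological
  group whose underlying space carries a smooth atlas A of charts into the model
  space 'v, such that multiplication and inversion are smooth in charts.\<close>

definition lie_group :: "'g::topological_space monoid \<Rightarrow> ('g set \<times> ('g \<Rightarrow> 'v::euclidean_space)) set \<Rightarrow> bool" where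
  "lie_group G A \<longleftrightarrow>
     group G \<and> carrier G = UNIV \<and>
     continuous_on UNIV (\<lambda>p. fst p \<otimes>\<^bsub>G\<^esub> snd p) \<and>
     continuous_on UNIV (\<lambda>x. inv\<^bsub>G\<^esub> x) \<and>
     (\<forall>(U, \<phi>)\<in>A. open U \<and> open (\<phi> ` U) \<and> homeomorphism U (\<phi> ` U) \<phi> (inv_into U \<phi>)) \<and>
     (\<forall>x. \<exists>(U, \<phi>)\<in>A. x \<in> U) \<and>
     (\<forall>(U, \<phi>)\<in>A. \<forall>(V, \<psi>)\<in>A. smooth_on (\<phi> ` (U \<inter> V)) (\<psi> \<circ> inv_into U \<phi>)) \<and>
     (\<forall>(U, \<phi>)\<in>A. \<forall>(V, \<psi>)\<in>A. \<forall>(W, \<xi>)\<in>A.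
        smooth_on {p \<in> \<phi> ` U \<times> \<psi> ` V. inv_into U \<phi> (fst p) \<otimes>\<^bsub>G\<^esub> inv_into V \<psi> (snd p) \<in> W}
                  (\<lambda>p. \<xi> (inv_into U \<phi> (fst p) \<otimes>\<^bsub>G\<^esub> inv_into V \<psi> (snd p)))) \<and>
     (\<forall>(U, \<phi>)\<in>A. \<forall>(V, \<psi>)\<in>A.
        smooth_on {y \<in> \<phi> ` U. inv\<^bsub>G\<^esub> (inv_into U \<phi> y) \<in> V} (\<lambda>y. \<psi> (inv\<^bsub>G\<^esub> (inv_into U \<phi> y))))"

definition endo_action :: "'g::topological_space monoid \<Rightarrow> 'm monoid \<Rightarrow> ('m \<Rightarrow> 'g \<Rightarrow> 'g) \<Rightarrow> bool" where
  "endo_action G M \<rho> \<longleftrightarrow> monoid M \<and>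
     (\<forall>\<gamma>\<in>carrier M. \<rho> \<gamma> \<in> hom G G \<and> continuous_on UNIV (\<rho> \<gamma>)) \<and>
     (\<forall>\<gamma>\<in>carrier M. \<forall>\<delta>\<in>carrier M. \<rho> (\<gamma> \<otimes>\<^bsub>M\<^esub> \<delta>) = \<rho> \<gamma> \<circ> \<rho> \<delta>)"

definition expansive :: "'g::topological_space monoid \<Rightarrow> 'm monoid \<Rightarrow> ('m \<Rightarrow> 'g \<Rightarrow> 'g) \<Rightarrow> bool" where
  "expansive G M \<rho> \<longleftrightarrow>
     (\<exists>U. open U \<and> \<one>\<^bsub>G\<^esub> \<in> U \<and> (\<Inter>\<gamma>\<in>carrier M. \<rho> \<gamma> -` U) = {\<one>\<^bsub>G\<^esub>})"

text \<open>Differential at the identity of an endomorphism f, read in the chart (U, phi)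
  around the identity: the Lie algebra L(G) = T_e G is identified with 'v via d phi_e.\<close>

definition diff_at_id :: "'g monoid \<Rightarrow> 'g set \<Rightarrow> ('g \<Rightarrow> 'v::real_normed_vector) \<Rightarrow> ('g \<Rightarrow> 'g) \<Rightarrow> 'v \<Rightarrow> 'v" where
  "diff_at_id G U \<phi> f = frechet_derivative (\<phi> \<circ> f \<circ> inv_into U \<phi>) (at (\<phi> \<one>\<^bsub>G\<^esub>))"

end

theory Submission
  imports Defs
begin

text \<open>No exponential map is needed. In a chart \<open>\<kappa>\<close> with \<open>\<kappa> \<one> = 0\<close>, multiplication being $C^1$ gives
  \<open>\<kappa> (a \<otimes> b) = \<kappa> a + \<kappa> b + o(norm (\<kappa> b))\<close>, hence \<open>\<kappa> (a\<^sup>n) = n \<kappa> a + o(n norm (\<kappa> a))\<close> as long as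
  \<open>n norm (\<kappa> a)\<close> is small. Applied to the orbits of a small element, this shows that a continuous
  endomorphism is Lipschitz and asymptotically linear in the chart near the identity, and therefore
  differentiable there.

  If all orbits of the derivatives are unbounded, compactness of the unit sphere yields finitely
  many \<open>\<gamma>\<close> such that every small element is pushed away from the identity by one of them, by a
  factor \<open>3/2\<close>; iterating, its orbit leaves a fixed ball. If the orbit of \<open>v \<noteq> 0\<close> is bounded, a limit
  point \<open>g\<close> of the elements with coordinates \<open>(t / 2\<^sup>n) v\<close>, raised to the power \<open>2\<^sup>n\<close>, is
  non-trivial, and its orbit stays close to the identity when \<open>t\<close> is small.\<close>

section \<open>Real analysis: linearity and differentiability from approximate functional
  equations\<close>

text \<open>The defect \<open>?h r\<close> is additive in \<open>r\<close> and vanishes at integers,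
  so \<open>real n *\<^sub>R ?h r\<close> is the defect at the fractional part of
  \<open>real n * r\<close>. This is bounded independently of \<open>n\<close>, hence
  \<open>?h r = 0\<close>.\<close>

lemma bounded_additive_imp_bounded_linear:
  fixes L :: "'a::real_normed_vector \<Rightarrow> 'b::real_normed_vector"
  assumes add: "\<And>x y. L (x + y) = L x + L y" and bound: "\<And>x. norm (L x) \<le> C * norm x"
  shows "bounded_linear L"
proof (rule bounded_linear_intro[of _ C])
  interpret additive L by unfold_locales (rule add)
  fix r x
  have L_nat: "L (real n *\<^sub>R y) = real n *\<^sub>R L y" for n y
    by (induction n) (simp_all add: zero add algebra_simps)
  have L_int: "L (of_int k *\<^sub>R y) = of_int k *\<^sub>R L y" for k y
  proof (cases k rule: int_cases2)
    case (nonneg n) then show ?thesis using L_nat by simp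
  next
    case (nonpos n) then show ?thesis using L_nat by (simp add: minus)
  qed
  let ?h = "\<lambda>r. L (r *\<^sub>R x) - r *\<^sub>R L x"
  have "real n * norm (?h r) \<le> 2 * \<bar>C * norm x\<bar>" for n
  proof -
    let ?f = "frac (real n * r)"
    have "real n *\<^sub>R ?h r = ?h (real n * r)"
      by (simp add: scaleR_diff_right flip: L_nat scaleR_scaleR)
    also have "real n * r = ?f + of_int \<lfloor>real n * r\<rfloor>" by (simp add: frac_def)
    also have "?h \<dots> = ?h ?f"
      by (simp only: scaleR_add_left add L_int) simp
    finally have "real n * norm (?h r) = norm (?h ?f)" by (metis norm_scaleR abs_of_nat)
    also have "\<dots> \<le> norm (L (?f *\<^sub>R x)) + norm (?f *\<^sub>R L x)" by (rule norm_triangle_ineq4)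
    also have "\<dots> \<le> \<bar>?f\<bar> * \<bar>C * norm x\<bar> + \<bar>?f\<bar> * \<bar>C * norm x\<bar>"
    proof (rule add_mono)
      have "norm (L (?f *\<^sub>R x)) \<le> \<bar>?f\<bar> * (C * norm x)" using bound[of "?f *\<^sub>R x"] by (simp add: mult.left_commute)
      also have "\<dots> \<le> \<bar>?f\<bar> * \<bar>C * norm x\<bar>" by (intro mult_left_mono) auto
      finally show "norm (L (?f *\<^sub>R x)) \<le> \<bar>?f\<bar> * \<bar>C * norm x\<bar>" .
      have "norm (L x) \<le> \<bar>C * norm x\<bar>" using bound[of x] by linarith
      then show "norm (?f *\<^sub>R L x) \<le> \<bar>?f\<bar> * \<bar>C * norm x\<bar>" by (simp add: mult_left_mono)
    qed
    also have "\<dots> \<le> 2 * \<bar>C * norm x\<bar>"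
      using mult_right_mono[of "\<bar>?f\<bar>" 1 "\<bar>C * norm x\<bar>"] frac_lt_1[of "real n * r"] frac_ge_0[of "real n * r"]
      by linarith
    finally show ?thesis .
  qed
  then have "norm (?h r) = 0"
    by (intro real_archimedian_rdiv_eq_0[of _ "2 * \<bar>C * norm x\<bar>"]) auto
  then show "L (r *\<^sub>R x) = r *\<^sub>R L x" by simp
qed (use add bound in \<open>auto simp: mult.commute\<close>)

text \<open>The derivative is the limit of the rescaled values \<open>X x n\<close>. The first
  hypothesis makes this sequence Cauchy, the second makes its limit additive in \<open>x\<close>,
  and the third bounds the limit, so that it is linear.\<close>

lemma has_derivative_zero_if_asymptotically_linear:
  fixes F :: "'a::real_normed_vector \<Rightarrow> 'b::banach"
  assumes mult: "\<And>\<epsilon>. \<epsilon> > 0 \<Longrightarrow> \<exists>\<delta>>0. \<forall>x n. real n * norm x < \<delta> \<longrightarrow> norm x < \<delta> \<longrightarrow>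
      norm (F (real n *\<^sub>R x) - real n *\<^sub>R F x) \<le> \<epsilon> * (real n * norm x)"
    and add: "\<And>\<epsilon>. \<epsilon> > 0 \<Longrightarrow> \<exists>\<delta>>0. \<forall>x y. norm x < \<delta> \<longrightarrow> norm y < \<delta> \<longrightarrow>
      norm (F (x + y) - F x - F y) \<le> \<epsilon> * (norm x + norm y)"
    and bound: "C \<ge> 0" "d > 0" "\<And>x. norm x < d \<Longrightarrow> norm (F x) \<le> C * norm x"
  shows "\<exists>L. (F has_derivative L) (at 0)"
proof -
  define X where "X x n = (2::real)^n *\<^sub>R F ((1/2^n) *\<^sub>R x)" for x n
  have small: "\<exists>N. \<forall>n\<ge>N. norm ((1/2^n) *\<^sub>R x) < \<delta>" if "\<delta> > 0" for x :: 'a and \<delta> :: real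
  proof -
    have "(\<lambda>n. (1/2)^n *\<^sub>R x) \<longlonglongrightarrow> 0 *\<^sub>R x"
      by (intro tendsto_intros LIMSEQ_realpow_zero) auto
    then have "\<forall>\<^sub>F n in sequentially. norm ((1/2)^n *\<^sub>R x) < \<delta>"
      using that by (auto simp: tendsto_iff dist_norm)
    then show ?thesis by (simp add: eventually_sequentially power_one_over)
  qed
  \<comment> \<open>A single use of the hypothesis, at the point \<open>z\<close> with multiplier
    \<open>2^k\<close>, covers all \<open>k\<close> halvings. Rescaling by \<open>2^n\<close> turns
    the error into \<open>\<epsilon> * norm x\<close>, independent of \<open>n\<close> and
    \<open>k\<close>.\<close>
  have tail: "norm (X x (n + k) - X x n) \<le> \<epsilon> * norm x"
    if "\<delta> > 0" and \<delta>: "\<forall>x n. real n * norm x < \<delta> \<longrightarrow> norm x < \<delta> \<longrightarrow>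
      norm (F (real n *\<^sub>R x) - real n *\<^sub>R F x) \<le> \<epsilon> * (real n * norm x)"
      and n: "norm ((1/2^n) *\<^sub>R x) < \<delta>" for \<delta> \<epsilon> x n k
  proof -
    define z where "z = (1/2^(n+k)) *\<^sub>R x"
    have z: "real (2^k) * norm z = norm ((1/2^n) *\<^sub>R x)"
      by (simp add: z_def power_add)
    have le: "norm z \<le> real (2^k) * norm z"
      by (simp add: mult_le_cancel_right1)
    have "norm (F (real (2^k) *\<^sub>R z) - real (2^k) *\<^sub>R F z) \<le> \<epsilon> * (real (2^k) * norm z)"
      using \<delta> z n le by (metis order_le_less_trans)
    then have "2^n * norm (F (real (2^k) *\<^sub>R z) - real (2^k) *\<^sub>R F z) \<le> 2^n * (\<epsilon> * (real (2^k) * norm z))"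
      by (intro mult_left_mono) auto
    also have "2^n * (\<epsilon> * (real (2^k) * norm z)) = \<epsilon> * norm x"
      unfolding z by simp
    also have "2^n * norm (F (real (2^k) *\<^sub>R z) - real (2^k) *\<^sub>R F z)
        = norm ((2::real)^n *\<^sub>R (F (real (2^k) *\<^sub>R z) - real (2^k) *\<^sub>R F z))" by simp
    also have "(2::real)^n *\<^sub>R (F (real (2^k) *\<^sub>R z) - real (2^k) *\<^sub>R F z) = X x n - X x (n + k)"
      by (simp add: X_def z_def scaleR_diff_right power_add)
    finally show ?thesis by (simp add: norm_minus_commute)
  qed
  have scale: "\<exists>\<epsilon>>0. \<epsilon> * t < e" if "e > 0" "t \<ge> 0" for e t :: real
  proof (intro exI conjI)
    show "e / (t + 1) > 0" "e / (t + 1) * t < e"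
      using that by (auto simp: divide_simps algebra_simps)
  qed
  have "Cauchy (X x)" for x
  proof (rule CauchyI')
    fix e :: real assume e: "e > 0"
    obtain \<epsilon> where \<epsilon>: "\<epsilon> > 0" "\<epsilon> * norm x < e"
      using scale[OF e, of "norm x"] by auto
    obtain \<delta> where \<delta>: "\<delta> > 0" "\<forall>x n. real n * norm x < \<delta> \<longrightarrow> norm x < \<delta> \<longrightarrow>
      norm (F (real n *\<^sub>R x) - real n *\<^sub>R F x) \<le> \<epsilon> * (real n * norm x)"
      using mult[OF \<epsilon>(1)] by blast
    obtain N where N: "\<forall>n\<ge>N. norm ((1/2^n) *\<^sub>R x) < \<delta>" using small[OF \<delta>(1)] by blast
    show "\<exists>M. \<forall>m\<ge>M. \<forall>n>m. dist (X x m) (X x n) < e"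
    proof (intro exI allI impI)
      fix m n assume "m \<ge> N" "n > m"
      then obtain k where "n = m + k" by (metis less_imp_add_positive)
      then show "dist (X x m) (X x n) < e"
        using tail[OF \<delta>, of m x k] N \<open>m \<ge> N\<close> \<epsilon>(2) by (simp add: dist_norm norm_minus_commute)
    qed
  qed
  then have L: "X x \<longlonglongrightarrow> lim (X x)" for x
    by (simp add: Cauchy_convergent_iff convergent_LIMSEQ_iff)
  define L where "L x = lim (X x)" for x
  note L = L[folded L_def]
  have L_bound: "norm (L x) \<le> C * norm x" for x
  proof (rule LIMSEQ_le_const2[OF tendsto_norm[OF L]])
    obtain N where N: "\<forall>n\<ge>N. norm ((1/2^n) *\<^sub>R x) < d" using small[OF bound(2)] by blast
    have "norm (X x n) \<le> C * norm x" if "n \<ge> N" for n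
    proof -
      have "norm (X x n) = 2^n * norm (F ((1/2^n) *\<^sub>R x))" by (simp add: X_def)
      also have "\<dots> \<le> 2^n * (C * norm ((1/2^n) *\<^sub>R x))"
        using N that by (intro mult_left_mono bound(3)) auto
      finally show ?thesis by simp
    qed
    then show "\<exists>N. \<forall>n\<ge>N. norm (X x n) \<le> C * norm x" by blast
  qed
  have L_add: "L (x + y) = L x + L y" for x y
  proof -
    have "(\<lambda>n. X (x + y) n - X x n - X y n) \<longlonglongrightarrow> 0"
    proof (rule LIMSEQ_I)
      fix e :: real assume e: "e > 0"
      obtain \<epsilon> where \<epsilon>: "\<epsilon> > 0" "\<epsilon> * (norm x + norm y) < e"
        using scale[OF e, of "norm x + norm y"] by auto
      obtain \<delta> where \<delta>: "\<delta> > 0" "\<forall>x y. norm x < \<delta> \<longrightarrow> norm y < \<delta> \<longrightarrow>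
          norm (F (x + y) - F x - F y) \<le> \<epsilon> * (norm x + norm y)" using add[OF \<epsilon>(1)] by blast
      obtain N1 where N1: "\<forall>n\<ge>N1. norm ((1/2^n) *\<^sub>R x) < \<delta>" using small[OF \<delta>(1)] by blast
      obtain N2 where N2: "\<forall>n\<ge>N2. norm ((1/2^n) *\<^sub>R y) < \<delta>" using small[OF \<delta>(1)] by blast
      show "\<exists>N. \<forall>n\<ge>N. norm (X (x + y) n - X x n - X y n - 0) < e"
      proof (intro exI allI impI)
        fix n assume n: "n \<ge> max N1 N2"
        let ?x = "(1/2^n) *\<^sub>R x" and ?y = "(1/2^n) *\<^sub>R y"
        have "X (x + y) n - X x n - X y n = (2::real)^n *\<^sub>R (F (?x + ?y) - F ?x - F ?y)"
          by (simp add: X_def scaleR_diff_right scaleR_add_right)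
        then have "norm (X (x + y) n - X x n - X y n) = 2^n * norm (F (?x + ?y) - F ?x - F ?y)"
          by simp
        also have "\<dots> \<le> 2^n * (\<epsilon> * (norm ?x + norm ?y))"
        proof (rule mult_left_mono)
          have "norm ?x < \<delta>" "norm ?y < \<delta>" using n N1 N2 by (metis max.bounded_iff)+
          then show "norm (F (?x + ?y) - F ?x - F ?y) \<le> \<epsilon> * (norm ?x + norm ?y)" using \<delta>(2) by blast
        qed simp
        also have "\<dots> = \<epsilon> * (norm x + norm y)" by (simp add: field_simps)
        finally show "norm (X (x + y) n - X x n - X y n - 0) < e" using \<epsilon>(2) by simp
      qed
    qed
    moreover have "(\<lambda>n. X (x + y) n - X x n - X y n) \<longlonglongrightarrow> L (x + y) - L x - L y"
      by (intro tendsto_intros L)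
    ultimately have "L (x + y) - L x - L y = 0" by (rule LIMSEQ_unique[rotated])
    then show ?thesis by (simp add: algebra_simps)
  qed
  have bl: "bounded_linear L" using L_add L_bound by (rule bounded_additive_imp_bounded_linear)
  have F0: "F 0 = 0" using bound(3)[of 0] bound(2) by simp
  have "(F has_derivative L) (at 0)"
    unfolding has_derivative_at_alt
  proof (intro conjI bl allI impI)
    fix \<epsilon> :: real assume \<epsilon>: "\<epsilon> > 0"
    obtain \<delta> where \<delta>: "\<delta> > 0" "\<forall>x n. real n * norm x < \<delta> \<longrightarrow> norm x < \<delta> \<longrightarrow>
      norm (F (real n *\<^sub>R x) - real n *\<^sub>R F x) \<le> \<epsilon> * (real n * norm x)"
      using mult[OF \<epsilon>(1)] by blast
    \<comment> \<open>\<open>tail\<close> at index 0 compares \<open>F x = X x 0\<close> with every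
      \<open>X x k\<close>; letting \<open>k\<close> tend to infinity replaces \<open>X x k\<close>
      by \<open>L x\<close>.\<close>
    have "norm (F x - L x) \<le> \<epsilon> * norm x" if x: "norm x < \<delta>" for x
    proof (rule LIMSEQ_le_const2)
      show "(\<lambda>k. norm (F x - X x k)) \<longlonglongrightarrow> norm (F x - L x)" by (intro tendsto_intros L)
      have "X x 0 = F x" by (simp add: X_def)
      then show "\<exists>N. \<forall>k\<ge>N. norm (F x - X x k) \<le> \<epsilon> * norm x"
        using tail[OF \<delta>, of 0 x] x by (simp add: norm_minus_commute)
    qed
    then show "\<exists>d>0. \<forall>y. norm (y - 0) < d \<longrightarrow> norm (F y - F 0 - L (y - 0)) \<le> \<epsilon> * norm (y - 0)"
      using \<delta>(1) F0 by auto
  qed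
  then show ?thesis by blast
qed

section \<open>Charts centred at the identity with strict control of multiplication\<close>

text \<open>In \<open>strict\<close> the error is measured by \<open>norm (\<kappa> b)\<close>
  alone. Repeated multiplication by the same small \<open>b\<close> therefore adds a fixed error per
  step, however far the first factor has moved within the ball.\<close>

locale strict_chart = group G for G :: "'g::t2_space monoid" (structure) +
  fixes U :: "'g set" and \<kappa> :: "'g \<Rightarrow> 'v::euclidean_space" and \<psi> :: "'v \<Rightarrow> 'g"
  assumes carrier_UNIV: "carrier G = UNIV"
    and continuous_mult: "continuous_on UNIV (\<lambda>p. fst p \<otimes> snd p)"
    and continuous_inv: "continuous_on UNIV (\<lambda>x. inv x)"
    and open_dom: "open U" and one_dom: "\<one> \<in> U"
    and open_image: "open (\<kappa> ` U)"
    and homeo: "homeomorphism U (\<kappa> ` U) \<kappa> \<psi>"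
    and \<kappa>_one: "\<kappa> \<one> = 0"
    and strict: "\<epsilon> > 0 \<Longrightarrow> \<exists>\<delta>>0. \<forall>a\<in>U. \<forall>b\<in>U. norm (\<kappa> a) < \<delta> \<longrightarrow> norm (\<kappa> b) < \<delta> \<longrightarrow>
      a \<otimes> b \<in> U \<and> norm (\<kappa> (a \<otimes> b) - \<kappa> a - \<kappa> b) \<le> \<epsilon> * norm (\<kappa> b)"
begin

text \<open>Membership in \<open>U\<close> is included because \<open>\<kappa>\<close> says nothing
  outside its domain. By \<open>open_B\<close>, \<open>one_B\<close> and \<open>B_subset\<close> the
  sets with positive radius form a neighbourhood base at the identity.\<close>

definition B :: "real \<Rightarrow> 'g set" where "B \<delta> = {a \<in> U. norm (\<kappa> a) < \<delta>}"

lemma in_carrier [simp]: "a \<in> carrier G" by (simp add: carrier_UNIV)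

lemma B_mono: "a \<in> B r \<Longrightarrow> r \<le> s \<Longrightarrow> a \<in> B s" by (auto simp: B_def)

lemma one_B: "r > 0 \<Longrightarrow> \<one> \<in> B r" by (auto simp: B_def one_dom \<kappa>_one)

lemma \<psi>_\<kappa>: "a \<in> U \<Longrightarrow> \<psi> (\<kappa> a) = a" using homeo by (simp add: homeomorphism_def)

lemma \<kappa>_eq_0: "a \<in> U \<Longrightarrow> \<kappa> a = 0 \<longleftrightarrow> a = \<one>" using \<psi>_\<kappa> \<kappa>_one one_dom by metis

lemma open_B: "open (B r)"
proof -
  have "B r = U \<inter> \<kappa> -` ball 0 r" by (auto simp: B_def)
  then show ?thesis using homeo open_dom
    by (simp add: continuous_open_preimage homeomorphism_cont1)
qed

lemma \<psi>_near: obtains r where "r > 0" "\<And>x. norm x < r \<Longrightarrow> \<psi> x \<in> U" "\<And>x. norm x < r \<Longrightarrow> \<kappa> (\<psi> x) = x"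
  "\<And>x. norm x < r \<Longrightarrow> isCont \<psi> x"
proof -
  have "0 \<in> \<kappa> ` U" using \<kappa>_one one_dom by (metis imageI)
  then obtain r where r: "r > 0" "ball 0 r \<subseteq> \<kappa> ` U" using open_image openE by blast
  have im: "x \<in> \<kappa> ` U" if "norm x < r" for x using that r(2) by auto
  have "isCont \<psi> x" if "norm x < r" for x
    using homeo im[OF that] open_image by (auto simp: homeomorphism_def continuous_on_eq_continuous_at)
  then show ?thesis using that[OF r(1)] im homeo by (fastforce simp: homeomorphism_def)
qed

lemma B_subset: assumes "open W" "\<one> \<in> W" obtains r where "r > 0" "B r \<subseteq> W"
proof -
  have "\<psi> 0 = \<one>" using \<psi>_\<kappa> \<kappa>_one one_dom by metis
  have "isCont \<psi> 0" by (rule \<psi>_near) simp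
  then have "\<forall>\<^sub>F x in nhds 0. \<psi> x \<in> W"
    using assms \<open>\<psi> 0 = \<one>\<close> by (metis isCont_def tendsto_def topological_tendstoD tendsto_at_iff_tendsto_nhds)
  then obtain r where r: "r > 0" "\<And>x. norm x < r \<Longrightarrow> \<psi> x \<in> W"
    by (auto simp: eventually_nhds_metric)
  have "B r \<subseteq> W" using r(2) \<psi>_\<kappa> by (fastforce simp: B_def)
  then show ?thesis using that r by blast
qed

lemma strictE:
  assumes "\<epsilon> > 0"
  obtains \<delta> where "\<delta> > 0"
    "\<And>a b. a \<in> B \<delta> \<Longrightarrow> b \<in> B \<delta> \<Longrightarrow> a \<otimes> b \<in> U"
    "\<And>a b. a \<in> B \<delta> \<Longrightarrow> b \<in> B \<delta> \<Longrightarrow> norm (\<kappa> (a \<otimes> b) - \<kappa> a - \<kappa> b) \<le> \<epsilon> * norm (\<kappa> b)"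
  using strict[OF assms] unfolding B_def by blast

section \<open>Powers and quotients of small elements\<close>

text \<open>Each further factor \<open>a\<close> contributes an error of at most
  \<open>e * norm (\<kappa> a)\<close>, and these errors add up. The bound on
  \<open>2 * real n * norm (\<kappa> a)\<close> keeps the intermediate powers in the ball where
  \<open>strict\<close> applies.\<close>

lemma pow_approx:
  assumes "\<epsilon> > 0"
  obtains \<delta> where "\<delta> > 0"
    "\<And>a n. a \<in> U \<Longrightarrow> 2 * real n * norm (\<kappa> a) < \<delta> \<Longrightarrow> a [^] n \<in> U"
    "\<And>a n. a \<in> U \<Longrightarrow> 2 * real n * norm (\<kappa> a) < \<delta> \<Longrightarrow>
       norm (\<kappa> (a [^] n) - real n *\<^sub>R \<kappa> a) \<le> \<epsilon> * (real n * norm (\<kappa> a))"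
    "\<And>a n. a \<in> U \<Longrightarrow> 2 * real n * norm (\<kappa> a) < \<delta> \<Longrightarrow> norm (\<kappa> (a [^] n)) \<le> 2 * real n * norm (\<kappa> a)"
proof -
  \<comment> \<open>The cap at 1 bounds the accumulated error by
    \<open>real n * norm (\<kappa> a)\<close>. This gives the factor 2 in the norm estimate, by
    which the induction stays inside \<open>B \<delta>\<close>.\<close>
  define e where "e = min \<epsilon> 1"
  have e: "e > 0" "e \<le> 1" "e \<le> \<epsilon>" using assms by (auto simp: e_def)
  obtain \<delta> where \<delta>: "\<delta> > 0"
    "\<And>a b. a \<in> B \<delta> \<Longrightarrow> b \<in> B \<delta> \<Longrightarrow> a \<otimes> b \<in> U"
    "\<And>a b. a \<in> B \<delta> \<Longrightarrow> b \<in> B \<delta> \<Longrightarrow> norm (\<kappa> (a \<otimes> b) - \<kappa> a - \<kappa> b) \<le> e * norm (\<kappa> b)"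
    using strictE[OF e(1)] by blast
  have *: "a [^] n \<in> U \<and> norm (\<kappa> (a [^] n) - real n *\<^sub>R \<kappa> a) \<le> e * (real n * norm (\<kappa> a))
      \<and> norm (\<kappa> (a [^] n)) \<le> 2 * real n * norm (\<kappa> a)"
    if a: "a \<in> U" and "2 * real n * norm (\<kappa> a) < \<delta>" for a n
    using that(2)
  proof (induction n)
    case 0 show ?case by (simp add: one_dom \<kappa>_one)
  next
    case (Suc n)
    let ?x = "norm (\<kappa> a)"
    have 0: "2 * real n * ?x \<le> 2 * real (Suc n) * ?x" "?x \<le> 2 * real (Suc n) * ?x"
      by (intro mult_right_mono; simp) (simp add: mult_le_cancel_right1)
    have IH: "a [^] n \<in> U" "norm (\<kappa> (a [^] n) - real n *\<^sub>R \<kappa> a) \<le> e * (real n * ?x)"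
      "norm (\<kappa> (a [^] n)) \<le> 2 * real n * ?x" using Suc 0 by auto
    have B: "a [^] n \<in> B \<delta>" "a \<in> B \<delta>" using IH a 0 Suc.prems by (auto simp: B_def)
    have "\<kappa> (a [^] Suc n) - real (Suc n) *\<^sub>R \<kappa> a
        = (\<kappa> (a [^] n \<otimes> a) - \<kappa> (a [^] n) - \<kappa> a) + (\<kappa> (a [^] n) - real n *\<^sub>R \<kappa> a)"
      by (simp add: algebra_simps)
    then have "norm (\<kappa> (a [^] Suc n) - real (Suc n) *\<^sub>R \<kappa> a) \<le> e * ?x + e * (real n * ?x)"
      using \<delta>(3)[OF B] IH(2) by (metis norm_triangle_mono)
    then have 1: "norm (\<kappa> (a [^] Suc n) - real (Suc n) *\<^sub>R \<kappa> a) \<le> e * (real (Suc n) * ?x)"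
      by (simp add: algebra_simps)
    have "norm (\<kappa> (a [^] Suc n)) \<le> norm (real (Suc n) *\<^sub>R \<kappa> a) + norm (\<kappa> (a [^] Suc n) - real (Suc n) *\<^sub>R \<kappa> a)"
      by (rule norm_triangle_sub)
    also have "\<dots> \<le> real (Suc n) * ?x + 1 * (real (Suc n) * ?x)"
      using order_trans[OF 1 mult_right_mono[OF e(2)]] by (intro add_mono) auto
    finally show ?case using 1 \<delta>(2)[OF B] by (simp add: algebra_simps)
  qed
  show ?thesis
  proof (rule that[OF \<delta>(1)])
    fix a :: 'g and n :: nat assume "a \<in> U" "2 * real n * norm (\<kappa> a) < \<delta>"
    note ** = *[OF this]
    have "e * (real n * norm (\<kappa> a)) \<le> \<epsilon> * (real n * norm (\<kappa> a))"
      by (intro mult_right_mono e) auto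
    with ** show "a [^] n \<in> U" "norm (\<kappa> (a [^] n) - real n *\<^sub>R \<kappa> a) \<le> \<epsilon> * (real n * norm (\<kappa> a))"
      "norm (\<kappa> (a [^] n)) \<le> 2 * real n * norm (\<kappa> a)" by auto
  qed
qed

text \<open>The induction of \<open>pow_approx\<close> is repeated with error \<open>1/2\<close>,
  but now the powers are assumed to stay in the ball. Then \<open>\<kappa> (a [^] n)\<close> has at
  least half the norm of \<open>real n *\<^sub>R \<kappa> a\<close>, while that norm is below
  \<open>\<delta>\<close>. Letting \<open>n\<close> grow, only the trivial subgroup lies in
  \<open>B \<delta>\<close>.\<close>

lemma no_small_subgroups:
  obtains \<delta> where "\<delta> > 0"
    "\<And>a n. (\<And>k. k \<le> n \<Longrightarrow> a [^] k \<in> B \<delta>) \<Longrightarrow> real n * norm (\<kappa> a) \<le> 2 * \<delta>"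
proof -
  obtain \<delta> where \<delta>: "\<delta> > 0"
    "\<And>a b. a \<in> B \<delta> \<Longrightarrow> b \<in> B \<delta> \<Longrightarrow> norm (\<kappa> (a \<otimes> b) - \<kappa> a - \<kappa> b) \<le> (1/2) * norm (\<kappa> b)"
    by (rule strictE[of "1/2"]) auto
  have *: "norm (\<kappa> (a [^] n) - real n *\<^sub>R \<kappa> a) \<le> (1/2) * (real n * norm (\<kappa> a))"
    if "\<And>k. k \<le> n \<Longrightarrow> a [^] k \<in> B \<delta>" for a n
    using that
  proof (induction n)
    case 0 show ?case by (simp add: \<kappa>_one)
  next
    case (Suc n)
    have B: "a [^] n \<in> B \<delta>" "a \<in> B \<delta>" using Suc.prems[of n] Suc.prems[of 1] by auto
    have "\<kappa> (a [^] Suc n) - real (Suc n) *\<^sub>R \<kappa> a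
        = (\<kappa> (a [^] n \<otimes> a) - \<kappa> (a [^] n) - \<kappa> a) + (\<kappa> (a [^] n) - real n *\<^sub>R \<kappa> a)"
      by (simp add: algebra_simps)
    then have "norm (\<kappa> (a [^] Suc n) - real (Suc n) *\<^sub>R \<kappa> a) \<le> 1/2 * norm (\<kappa> a) + 1/2 * (real n * norm (\<kappa> a))"
      using \<delta>(2)[OF B] Suc.IH Suc.prems by (metis norm_triangle_mono le_SucI)
    then show ?case by (simp add: algebra_simps)
  qed
  show ?thesis
  proof (rule that[OF \<delta>(1)])
    fix a :: 'g and n :: nat assume a: "\<And>k. k \<le> n \<Longrightarrow> a [^] k \<in> B \<delta>"
    have "norm (real n *\<^sub>R \<kappa> a) \<le> norm (\<kappa> (a [^] n)) + norm (real n *\<^sub>R \<kappa> a - \<kappa> (a [^] n))"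
      by (rule norm_triangle_sub)
    also have "\<dots> \<le> \<delta> + (1/2) * (real n * norm (\<kappa> a))"
      using *[OF a] a[of n] by (auto simp: B_def norm_minus_commute intro!: add_mono)
    finally show "real n * norm (\<kappa> a) \<le> 2 * \<delta>" by simp
  qed
qed

text \<open>Strictness with error \<open>1/2\<close>, applied to \<open>a = b \<otimes> w\<close>
  with \<open>w = inv b \<otimes> a\<close>, bounds
  \<open>norm (\<kappa> a - \<kappa> b - \<kappa> w)\<close> by half of
  \<open>norm (\<kappa> w)\<close>, which is then absorbed. Continuity of the quotient map puts
  \<open>w\<close> in the ball where this is allowed.\<close>

lemma quotient_bound:
  assumes "r > 0"
  obtains \<delta> where "\<delta> > 0" 
    "\<And>a b. a \<in> B \<delta> \<Longrightarrow> b \<in> B \<delta> \<Longrightarrow> inv b \<otimes> a \<in> B r"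
    "\<And>a b. a \<in> B \<delta> \<Longrightarrow> b \<in> B \<delta> \<Longrightarrow> norm (\<kappa> (inv b \<otimes> a)) \<le> 2 * norm (\<kappa> a - \<kappa> b)"
proof -
  obtain s where s: "s > 0"
    "\<And>a b. a \<in> B s \<Longrightarrow> b \<in> B s \<Longrightarrow> norm (\<kappa> (a \<otimes> b) - \<kappa> a - \<kappa> b) \<le> (1/2) * norm (\<kappa> b)"
    by (rule strictE[of "1/2"]) auto
  let ?q = "\<lambda>p. inv (snd p) \<otimes> fst p"
  have "continuous_on UNIV ((\<lambda>p. fst p \<otimes> snd p) \<circ> (\<lambda>p::'g\<times>'g. (inv (snd p), fst p)))"
    by (intro continuous_on_compose continuous_on_Pair continuous_intros
        continuous_on_compose2[OF continuous_inv] continuous_on_subset[OF continuous_mult]) auto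
  then have "continuous_on UNIV ?q" by (simp add: o_def)
  then have "open (?q -` B (min r s))"
    by (rule open_vimage[OF open_B])
  moreover have "(\<one>, \<one>) \<in> ?q -` B (min r s)" using one_B \<open>r > 0\<close> s(1) by simp
  ultimately obtain V W where VW: "open V" "open W" "\<one> \<in> V" "\<one> \<in> W" "V \<times> W \<subseteq> ?q -` B (min r s)"
    using open_prod_elim[of "?q -` B (min r s)" "(\<one>, \<one>)"] by (metis mem_Sigma_iff)
  obtain d where d: "d > 0" "B d \<subseteq> V \<inter> W" using B_subset[of "V \<inter> W"] VW by auto
  define \<delta> where "\<delta> = min d s"
  have q: "inv b \<otimes> a \<in> B (min r s)" if "a \<in> B \<delta>" "b \<in> B \<delta>" for a b
  proof -
    have "(a, b) \<in> V \<times> W" using that d(2) B_mono[of _ \<delta> d] by (auto simp: \<delta>_def)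
    then show ?thesis using VW(5) by auto
  qed
  show ?thesis
  proof (rule that(1)[of \<delta>])
    show "\<delta> > 0" using d s by (simp add: \<delta>_def)
    fix a b assume ab: "a \<in> B \<delta>" "b \<in> B \<delta>"
    show "inv b \<otimes> a \<in> B r" using q[OF ab] B_mono by fastforce
    have w: "inv b \<otimes> a \<in> B s" using q[OF ab] B_mono by fastforce
    have b: "b \<in> B s" using ab B_mono[of b \<delta> s] by (auto simp: \<delta>_def)
    have "b \<otimes> (inv b \<otimes> a) = a" by (simp add: m_assoc[symmetric])
    then have "norm (\<kappa> a - \<kappa> b - \<kappa> (inv b \<otimes> a)) \<le> (1/2) * norm (\<kappa> (inv b \<otimes> a))"
      using s(2)[OF b w] by simp
    moreover have "norm (\<kappa> (inv b \<otimes> a)) \<le> norm (\<kappa> a - \<kappa> b) + norm (\<kappa> (inv b \<otimes> a) - (\<kappa> a - \<kappa> b))"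
      by (rule norm_triangle_sub)
    ultimately show "norm (\<kappa> (inv b \<otimes> a)) \<le> 2 * norm (\<kappa> a - \<kappa> b)"
      by (simp add: norm_minus_commute)
  qed
qed


section \<open>Continuous endomorphisms are differentiable at the identity\<close>

context
  fixes f assumes f_hom: "f \<in> hom G G" and f_cont: "continuous_on UNIV f"
begin

lemma f_mult: "f (a \<otimes> b) = f a \<otimes> f b" using f_hom by (simp add: hom_mult)

lemma f_one: "f \<one> = \<one>" using hom_one[OF f_hom] is_group by blast

lemma f_pow: "f (a [^] (n::nat)) = f a [^] n" by (induction n) (simp_all add: f_one f_mult)

lemma hom_near:
  assumes "r > 0"
  obtains \<delta> where "\<delta> > 0" "\<And>a. a \<in> B \<delta> \<Longrightarrow> f a \<in> B r"
proof (rule B_subset)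
  show "open (f -` B r)" using open_vimage[OF open_B f_cont] .
  show "\<one> \<in> f -` B r" using one_B[OF assms] by (simp add: f_one)
qed (use that in blast)

lemma hom_near_dom: obtains \<delta> where "\<delta> > 0" "\<And>a. a \<in> B \<delta> \<Longrightarrow> f a \<in> U"
proof (rule hom_near[of 1])
  fix \<delta> assume "\<delta> > 0" "\<And>a. a \<in> B \<delta> \<Longrightarrow> f a \<in> B 1"
  then show thesis by (intro that) (auto simp: B_def)
qed simp

text \<open>A small \<open>a\<close> has about \<open>1 / norm (\<kappa> a)\<close> powers near the
  identity. By continuity \<open>f\<close> maps them to powers of \<open>f a\<close> near the
  identity, and \<open>no_small_subgroups\<close> then forces \<open>f a\<close> to be
  correspondingly small.\<close>

lemma hom_bound:
  obtains C \<delta> where "C \<ge> 0" "\<delta> > 0" "\<And>a. a \<in> B \<delta> \<Longrightarrow> norm (\<kappa> (f a)) \<le> C * norm (\<kappa> a)"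
proof -
  obtain s where s: "s > 0"
    "\<And>a n. (\<And>k. k \<le> n \<Longrightarrow> a [^] k \<in> B s) \<Longrightarrow> real n * norm (\<kappa> a) \<le> 2 * s"
    using no_small_subgroups by blast
  obtain d where d: "d > 0" "\<And>a. a \<in> B d \<Longrightarrow> f a \<in> B s" using hom_near[OF s(1)] by blast
  obtain p where p: "p > 0"
    "\<And>a n. a \<in> U \<Longrightarrow> 2 * real n * norm (\<kappa> a) < p \<Longrightarrow> a [^] n \<in> U"
    "\<And>a n. a \<in> U \<Longrightarrow> 2 * real n * norm (\<kappa> a) < p \<Longrightarrow> norm (\<kappa> (a [^] n)) \<le> 2 * real n * norm (\<kappa> a)"
    by (rule pow_approx[of 1]) auto
  define q where "q = min p d"
  have q: "q > 0" "q \<le> p" "q \<le> d" using p(1) d(1) by (auto simp: q_def)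
  have main: "norm (\<kappa> (f a)) \<le> (16 * s / q) * norm (\<kappa> a)" if a: "a \<in> B (q/4)" for a
  proof (cases "\<kappa> a = 0")
    case True
    then show ?thesis using a \<kappa>_eq_0[of a] by (simp add: B_def f_one \<kappa>_one)
  next
    case False
    define x y where "x = norm (\<kappa> a)" and "y = norm (\<kappa> (f a))"
    have x: "x > 0" "x < q / 4" "a \<in> U" using False a by (auto simp: x_def B_def)
    \<comment> \<open>With this \<open>t\<close>, \<open>2 * k * x \<le> q / 2\<close> for
      \<open>k \<le> t\<close>, which keeps these powers in \<open>B d\<close>. Since
      \<open>t \<ge> 1\<close>, rounding down loses at most a factor 2, whence the constant
      16.\<close>
    define t n where "t = q / (4 * x)" and "n = nat \<lfloor>t\<rfloor>"
    have "t \<ge> 1" using x by (simp add: t_def field_simps)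
    then have "real n = of_int \<lfloor>t\<rfloor>" "\<lfloor>t\<rfloor> \<ge> 1" by (simp_all add: n_def)
    then have "real n \<le> t" "real n \<ge> t / 2" by linarith+
    then have n: "real n \<le> q / (4 * x)" "real n \<ge> q / (4 * x) / 2" by (simp_all add: t_def)
    have "a [^] k \<in> B d" if "k \<le> n" for k
    proof -
      have "2 * real k * x \<le> 2 * (q / (4 * x)) * x"
        using n(1) that x(1) by (intro mult_right_mono mult_left_mono) auto
      also have "\<dots> = q / 2" using x(1) by simp
      also have "\<dots> < q" using q(1) by simp
      finally show ?thesis
        using p(2,3)[OF x(3), of k] q by (auto simp: B_def x_def)
    qed
    then have "real n * y \<le> 2 * s"
      unfolding y_def using d(2) by (intro s(2)) (simp flip: f_pow)
    moreover have "q / (4 * x) / 2 * y \<le> real n * y"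
      using n(2) by (intro mult_right_mono) (auto simp: y_def)
    ultimately have "q / (4 * x) / 2 * y \<le> 2 * s" by linarith
    then have "y \<le> (16 * s / q) * x" using x(1) q(1) by (simp add: field_simps)
    then show ?thesis by (simp add: x_def y_def)
  qed
  show ?thesis by (rule that[OF _ _ main]) (use s q in auto)
qed

text \<open>Since \<open>f a = f b \<otimes> f w\<close> for the quotient \<open>w\<close>,
  strictness reduces the claim to the size of \<open>f w\<close>, which \<open>hom_bound\<close> and
  \<open>quotient_bound\<close> estimate. Arguments of \<open>f\<close> with nearly equal
  coordinates can thus be exchanged.\<close>

lemma hom_lipschitz:
  obtains C \<delta> where "C \<ge> 0" "\<delta> > 0"
    "\<And>a b. a \<in> B \<delta> \<Longrightarrow> b \<in> B \<delta> \<Longrightarrow> norm (\<kappa> (f a) - \<kappa> (f b)) \<le> C * norm (\<kappa> a - \<kappa> b)"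
proof -
  obtain s where s: "s > 0"
    "\<And>a b. a \<in> B s \<Longrightarrow> b \<in> B s \<Longrightarrow> norm (\<kappa> (a \<otimes> b) - \<kappa> a - \<kappa> b) \<le> 1 * norm (\<kappa> b)"
    by (rule strictE[of 1]) auto
  obtain d where d: "d > 0" "\<And>a. a \<in> B d \<Longrightarrow> f a \<in> B s" using hom_near[OF s(1)] by blast
  obtain C d' where C: "C \<ge> 0" "d' > 0" "\<And>a. a \<in> B d' \<Longrightarrow> norm (\<kappa> (f a)) \<le> C * norm (\<kappa> a)"
    using hom_bound by blast
  obtain q where q: "q > 0"
    "\<And>a b. a \<in> B q \<Longrightarrow> b \<in> B q \<Longrightarrow> inv b \<otimes> a \<in> B (min d d')"
    "\<And>a b. a \<in> B q \<Longrightarrow> b \<in> B q \<Longrightarrow> norm (\<kappa> (inv b \<otimes> a)) \<le> 2 * norm (\<kappa> a - \<kappa> b)"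
    using quotient_bound[of "min d d'"] d(1) C(2) by auto
  show ?thesis
  proof (rule that[of "4 * C" "min d q"])
    fix a b assume ab: "a \<in> B (min d q)" "b \<in> B (min d q)"
    define w where "w = inv b \<otimes> a"
    have ab': "a \<in> B q" "b \<in> B q" "b \<in> B d" using ab B_mono by fastforce+
    have w: "w \<in> B d" "w \<in> B d'" using q(2)[OF ab'(1,2)] B_mono unfolding w_def by fastforce+
    have "b \<otimes> w = a" by (simp add: w_def m_assoc[symmetric])
    then have "f a = f b \<otimes> f w" using f_mult by metis
    then have "norm (\<kappa> (f a) - \<kappa> (f b) - \<kappa> (f w)) \<le> norm (\<kappa> (f w))"
      using s(2)[of "f b" "f w"] d(2) ab'(3) w(1) by simp
    then have "norm (\<kappa> (f a) - \<kappa> (f b)) \<le> 2 * norm (\<kappa> (f w))"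
      using norm_triangle_sub[of "\<kappa> (f a) - \<kappa> (f b)" "\<kappa> (f w)"] by simp
    also have "\<dots> \<le> 2 * (C * norm (\<kappa> w))" using C(3)[OF w(2)] by simp
    also have "\<dots> \<le> 2 * (C * (2 * norm (\<kappa> a - \<kappa> b)))"
      unfolding w_def using C(1) q(3)[OF ab'(1,2)] by (intro mult_left_mono) auto
    finally show "norm (\<kappa> (f a) - \<kappa> (f b)) \<le> 4 * C * norm (\<kappa> a - \<kappa> b)" by simp
  qed (use C d q in auto)
qed

text \<open>Both approximate functional equations are checked by a detour through the group, where
  \<open>f\<close> is exactly multiplicative: \<open>\<psi> (real n *\<^sub>R x)\<close> is replaced
  by \<open>a [^] n\<close>, and \<open>\<psi> (x + y)\<close> by \<open>a \<otimes> b\<close>.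
  \<open>hom_lipschitz\<close> bounds the cost of each replacement; \<open>pow_approx\<close> and
  \<open>strict\<close> estimate the images.\<close>

lemma hom_differentiable: "(\<kappa> \<circ> f \<circ> \<psi>) differentiable at 0"
proof -
  define F where "F = \<kappa> \<circ> f \<circ> \<psi>"
  obtain C0 d0 where C0: "C0 \<ge> 0" "d0 > 0" "\<And>a. a \<in> B d0 \<Longrightarrow> norm (\<kappa> (f a)) \<le> C0 * norm (\<kappa> a)"
    using hom_bound by blast
  obtain C1 d1 where C1: "C1 \<ge> 0" "d1 > 0"
    "\<And>a b. a \<in> B d1 \<Longrightarrow> b \<in> B d1 \<Longrightarrow> norm (\<kappa> (f a) - \<kappa> (f b)) \<le> C1 * norm (\<kappa> a - \<kappa> b)"
    using hom_lipschitz by blast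
  obtain r where r: "r > 0" "\<And>x. norm x < r \<Longrightarrow> \<psi> x \<in> U" "\<And>x. norm x < r \<Longrightarrow> \<kappa> (\<psi> x) = x"
    by (rule \<psi>_near) auto
  obtain u where u: "u > 0" "\<And>a. a \<in> B u \<Longrightarrow> f a \<in> U"
    using hom_near_dom by blast
  have \<psi>_B: "\<psi> x \<in> B t" if "norm x < r" "norm x < t" for x t
    using that r by (simp add: B_def)
  \<comment> \<open>\<open>C1\<close> accounts for the replacement of the argument of
    \<open>f\<close>, \<open>C0\<close> for the error among the images; \<open>e\<close> must absorb
    both.\<close>
  have small: "\<exists>e>0. e \<le> 1 \<and> e * (C0 + C1) \<le> \<epsilon>" if "\<epsilon> > 0" for \<epsilon> :: real
  proof (intro exI conjI)
    let ?e = "min 1 (\<epsilon> / (C0 + C1 + 1))"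
    show "?e > 0" "?e \<le> 1" using C0(1) C1(1) that by auto
    have "?e * (C0 + C1) \<le> \<epsilon> / (C0 + C1 + 1) * (C0 + C1 + 1)"
      using C0(1) C1(1) that by (intro mult_mono) auto
    also have "\<dots> = \<epsilon>" using C0(1) C1(1) by simp
    finally show "?e * (C0 + C1) \<le> \<epsilon>" .
  qed
  have "\<exists>L. (F has_derivative L) (at 0)"
  proof (rule has_derivative_zero_if_asymptotically_linear)
    show "C0 \<ge> 0" "min d0 r > 0" using C0 r by auto
    show "norm (F x) \<le> C0 * norm x" if "norm x < min d0 r" for x
      using C0(3)[OF \<psi>_B, of x] r(3)[of x] that by (simp add: F_def)
  next
    fix \<epsilon> :: real assume "\<epsilon> > 0"
    then obtain e where e: "e > 0" "e * (C0 + C1) \<le> \<epsilon>" using small by blast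
    obtain p where p: "p > 0"
      "\<And>a n. a \<in> U \<Longrightarrow> 2 * real n * norm (\<kappa> a) < p \<Longrightarrow> a [^] n \<in> U"
      "\<And>a n. a \<in> U \<Longrightarrow> 2 * real n * norm (\<kappa> a) < p \<Longrightarrow>
         norm (\<kappa> (a [^] n) - real n *\<^sub>R \<kappa> a) \<le> e * (real n * norm (\<kappa> a))"
      "\<And>a n. a \<in> U \<Longrightarrow> 2 * real n * norm (\<kappa> a) < p \<Longrightarrow> norm (\<kappa> (a [^] n)) \<le> 2 * real n * norm (\<kappa> a)"
      using pow_approx[OF e(1)] by blast
    \<comment> \<open>The two bounds by \<open>p\<close> make \<open>pow_approx\<close> applicable
      to \<open>a\<close> and to \<open>f a\<close>, whose coordinates are at most \<open>C0\<close>
      times as large. The half in \<open>d1/2\<close> covers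
      \<open>norm (\<kappa> (a [^] n)) \<le> 2 * real n * norm x\<close>.\<close>
    define \<delta> where "\<delta> = Min {p/2, p/(2*(C0+1)), r, d1/2, d0, u}"
    have "\<delta> > 0" using p(1) r(1) C0(1,2) C1(2) u(1) by (simp add: \<delta>_def)
    moreover have "\<delta> \<le> p/2" "\<delta> \<le> p/(2*(C0+1))" "\<delta> \<le> r" "\<delta> \<le> d1/2" "\<delta> \<le> d0" "\<delta> \<le> u"
      unfolding \<delta>_def by (rule Min_le; simp)+
    ultimately have \<delta>: "\<delta> > 0" "\<delta> \<le> p/2" "\<delta> \<le> p/(2*(C0+1))" "\<delta> \<le> r" "\<delta> \<le> d1/2" "\<delta> \<le> d0" "\<delta> \<le> u" .
    have "norm (F (real n *\<^sub>R x) - real n *\<^sub>R F x) \<le> \<epsilon> * (real n * norm x)"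
      if nx: "real n * norm x < \<delta>" and x: "norm x < \<delta>" for n x
    proof -
      define a where "a = \<psi> x"
      have a: "a \<in> B d0" "a \<in> U" "f a \<in> U" "\<kappa> a = x"
        unfolding a_def using x \<delta> r u(2) \<psi>_B by auto
      have pw: "2 * real n * norm (\<kappa> a) < p" using nx \<delta> a by simp
      have an: "a [^] n \<in> B d1" using p(2,4)[OF a(2) pw] nx \<delta> a(4) by (auto simp: B_def)
      have bn: "\<psi> (real n *\<^sub>R x) \<in> B d1" "\<kappa> (\<psi> (real n *\<^sub>R x)) = real n *\<^sub>R x"
        using \<psi>_B[of "real n *\<^sub>R x"] r(3)[of "real n *\<^sub>R x"] nx \<delta> C1(2) by auto
      have fa: "real n * norm (\<kappa> (f a)) \<le> C0 * (real n * norm x)"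
        using mult_left_mono[OF C0(3)[OF a(1)], of "real n"] a(4) by (simp add: mult.left_commute)
      have "2 * real n * norm (\<kappa> (f a)) \<le> 2 * (C0 * (real n * norm x))" using fa by simp
      also have "\<dots> \<le> 2 * ((C0 + 1) * (real n * norm x))"
        by (intro mult_left_mono mult_right_mono) auto
      also have "\<dots> < 2 * ((C0 + 1) * (p / (2 * (C0 + 1))))"
        using nx \<delta> C0(1) by (intro mult_strict_left_mono) auto
      also have "\<dots> = p" using C0(1) by (simp add: field_simps)
      finally have pf: "2 * real n * norm (\<kappa> (f a)) < p" .
      have "norm (\<kappa> (f (a [^] n)) - real n *\<^sub>R \<kappa> (f a)) \<le> e * (real n * norm (\<kappa> (f a)))"
        using p(3)[OF a(3) pf] by (simp add: f_pow)
      also have "\<dots> \<le> e * (C0 * (real n * norm x))" using fa e(1) by (intro mult_left_mono) auto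
      finally have 1: "norm (\<kappa> (f (a [^] n)) - real n *\<^sub>R \<kappa> (f a)) \<le> e * (C0 * (real n * norm x))" .
      have "norm (F (real n *\<^sub>R x) - \<kappa> (f (a [^] n))) \<le> C1 * norm (real n *\<^sub>R x - \<kappa> (a [^] n))"
        using C1(3)[OF bn(1) an] bn(2) by (simp add: F_def)
      also have "\<dots> \<le> C1 * (e * (real n * norm x))"
        using p(3)[OF a(2) pw] a(4) C1(1) by (intro mult_left_mono) (auto simp: norm_minus_commute)
      finally have 2: "norm (F (real n *\<^sub>R x) - \<kappa> (f (a [^] n))) \<le> C1 * (e * (real n * norm x))" .
      have "norm (F (real n *\<^sub>R x) - real n *\<^sub>R \<kappa> (f a))
          \<le> C1 * (e * (real n * norm x)) + e * (C0 * (real n * norm x))"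
        using norm_triangle_mono[OF 2 1] by simp
      also have "\<dots> = e * (C0 + C1) * (real n * norm x)" by (simp add: algebra_simps)
      also have "\<dots> \<le> \<epsilon> * (real n * norm x)" by (intro mult_right_mono e) auto
      finally show ?thesis by (simp add: F_def a_def)
    qed
    then show "\<exists>\<delta>>0. \<forall>x n. real n * norm x < \<delta> \<longrightarrow> norm x < \<delta> \<longrightarrow>
      norm (F (real n *\<^sub>R x) - real n *\<^sub>R F x) \<le> \<epsilon> * (real n * norm x)" using \<delta>(1) by blast
  next
    fix \<epsilon> :: real assume "\<epsilon> > 0"
    then obtain e where e: "e > 0" "e \<le> 1" "e * (C0 + C1) \<le> \<epsilon>" using small by blast
    obtain s where s: "s > 0"
      "\<And>a b. a \<in> B s \<Longrightarrow> b \<in> B s \<Longrightarrow> a \<otimes> b \<in> U"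
      "\<And>a b. a \<in> B s \<Longrightarrow> b \<in> B s \<Longrightarrow> norm (\<kappa> (a \<otimes> b) - \<kappa> a - \<kappa> b) \<le> e * norm (\<kappa> b)"
      using strictE[OF e(1)] by blast
    obtain q where q: "q > 0" "\<And>a. a \<in> B q \<Longrightarrow> f a \<in> B s" using hom_near[OF s(1)] by blast
    \<comment> \<open>The norm of \<open>x + y\<close> is below \<open>2 * \<delta>\<close>, and
      that of \<open>\<kappa> (a \<otimes> b)\<close> is below \<open>3 * \<delta>\<close> because
      \<open>e \<le> 1\<close>; hence \<open>r/2\<close> and \<open>d1/3\<close>.\<close>
    define \<delta> where "\<delta> = Min {s, q, r/2, d1/3, d0}"
    have "\<delta> > 0" using s(1) q(1) r(1) C0(2) C1(2) by (simp add: \<delta>_def)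
    moreover have "\<delta> \<le> s" "\<delta> \<le> q" "\<delta> \<le> r/2" "\<delta> \<le> d1/3" "\<delta> \<le> d0"
      unfolding \<delta>_def by (rule Min_le; simp)+
    ultimately have \<delta>: "\<delta> > 0" "\<delta> \<le> s" "\<delta> \<le> q" "\<delta> \<le> r/2" "\<delta> \<le> d1/3" "\<delta> \<le> d0" .
    have "norm (F (x + y) - F x - F y) \<le> \<epsilon> * (norm x + norm y)"
      if x: "norm x < \<delta>" and y: "norm y < \<delta>" for x y
    proof -
      define a b where "a = \<psi> x" and "b = \<psi> y"
      have a: "a \<in> B s" "f a \<in> B s" "\<kappa> a = x"
        unfolding a_def using x \<delta> r(1,3) q(2) \<psi>_B by auto
      have b: "b \<in> B s" "f b \<in> B s" "b \<in> B d0" "\<kappa> b = y"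
        unfolding b_def using y \<delta> r(1,3) q(2) \<psi>_B by auto
      have ab: "norm (\<kappa> (a \<otimes> b) - (x + y)) \<le> e * norm y"
        using s(3)[OF a(1) b(1)] a b by (simp add: algebra_simps)
      have "e * norm y \<le> norm y" using mult_right_mono[OF e(2), of "norm y"] by simp
      then have "norm (\<kappa> (a \<otimes> b)) \<le> norm x + norm y + norm y"
        using ab norm_triangle_sub[of "\<kappa> (a \<otimes> b)" "x + y"] norm_triangle_ineq[of x y] by linarith
      then have abB: "a \<otimes> b \<in> B d1" using s(2)[OF a(1) b(1)] x y \<delta> by (auto simp: B_def)
      have xy: "norm (x + y) < r" "norm (x + y) < d1"
        using x y \<delta> norm_triangle_ineq[of x y] by linarith+
      have "norm (F (x + y) - \<kappa> (f (a \<otimes> b))) \<le> C1 * norm (x + y - \<kappa> (a \<otimes> b))"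
        using C1(3)[OF \<psi>_B[OF xy] abB] r(3)[OF xy(1)] by (simp add: F_def)
      also have "\<dots> \<le> C1 * (e * norm y)"
        using ab C1(1) by (intro mult_left_mono) (auto simp: norm_minus_commute)
      finally have 1: "norm (F (x + y) - \<kappa> (f (a \<otimes> b))) \<le> C1 * (e * norm y)" .
      have "norm (\<kappa> (f (a \<otimes> b)) - F x - F y) \<le> e * norm (\<kappa> (f b))"
        using s(3)[OF a(2) b(2)] by (simp add: F_def a_def b_def f_mult)
      also have "\<dots> \<le> e * (C0 * norm y)"
        using C0(3)[OF b(3)] b(4) e(1) by (intro mult_left_mono) auto
      finally have 2: "norm (\<kappa> (f (a \<otimes> b)) - F x - F y) \<le> e * (C0 * norm y)" .
      have "norm (F (x + y) - F x - F y) \<le> C1 * (e * norm y) + e * (C0 * norm y)"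
        using norm_triangle_mono[OF 1 2] by (simp add: algebra_simps)
      also have "\<dots> = e * (C0 + C1) * norm y" by (simp add: algebra_simps)
      also have "\<dots> \<le> \<epsilon> * (norm x + norm y)" using \<open>\<epsilon> > 0\<close> e(3) by (intro mult_mono) auto
      finally show ?thesis .
    qed
    then show "\<exists>\<delta>>0. \<forall>x y. norm x < \<delta> \<longrightarrow> norm y < \<delta> \<longrightarrow>
      norm (F (x + y) - F x - F y) \<le> \<epsilon> * (norm x + norm y)" using \<delta>(1) by blast
  qed
  then show ?thesis by (auto simp: F_def differentiable_def)
qed

lemma hom_derivative_approx:
  defines "D \<equiv> frechet_derivative (\<kappa> \<circ> f \<circ> \<psi>) (at 0)"
  shows "linear D"
    and "\<epsilon> > 0 \<Longrightarrow> \<exists>\<delta>>0. \<forall>a\<in>B \<delta>. f a \<in> U \<and> norm (\<kappa> (f a) - D (\<kappa> a)) \<le> \<epsilon> * norm (\<kappa> a)"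
proof -
  have D: "((\<kappa> \<circ> f \<circ> \<psi>) has_derivative D) (at 0)"
    using hom_differentiable unfolding D_def by (simp add: frechet_derivative_works)
  then show "linear D" by (rule has_derivative_linear)
  assume "\<epsilon> > 0"
  then obtain d where d: "d > 0" "\<And>y. norm y < d \<Longrightarrow>
      norm ((\<kappa> \<circ> f \<circ> \<psi>) y - (\<kappa> \<circ> f \<circ> \<psi>) 0 - D y) \<le> \<epsilon> * norm y"
    using D unfolding has_derivative_at_alt by auto
  have "\<psi> 0 = \<one>" using \<psi>_\<kappa> \<kappa>_one one_dom by metis
  then have 0: "(\<kappa> \<circ> f \<circ> \<psi>) 0 = 0" by (simp add: f_one \<kappa>_one)
  obtain u where u: "u > 0" "\<And>a. a \<in> B u \<Longrightarrow> f a \<in> U"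
    using hom_near_dom by blast
  show "\<exists>\<delta>>0. \<forall>a\<in>B \<delta>. f a \<in> U \<and> norm (\<kappa> (f a) - D (\<kappa> a)) \<le> \<epsilon> * norm (\<kappa> a)"
  proof (intro exI conjI ballI)
    show "min d u > 0" using d u by simp
    fix a assume a: "a \<in> B (min d u)"
    show "f a \<in> U" using a B_mono u(2) by fastforce
    show "norm (\<kappa> (f a) - D (\<kappa> a)) \<le> \<epsilon> * norm (\<kappa> a)"
      using a d(2)[of "\<kappa> a"] 0 \<psi>_\<kappa> by (auto simp: B_def)
  qed
qed

end

section \<open>Expansiveness and the orbits of the differentials\<close>

context
  fixes M :: "'m monoid" and \<rho> :: "'m \<Rightarrow> 'g \<Rightarrow> 'g" and D :: "'m \<Rightarrow> 'v \<Rightarrow> 'v"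
  assumes action: "endo_action G M \<rho>" and \<rho>_id: "\<rho> \<one>\<^bsub>M\<^esub> = id"
  defines "D \<equiv> \<lambda>\<gamma>. frechet_derivative (\<kappa> \<circ> \<rho> \<gamma> \<circ> \<psi>) (at 0)"
begin

lemma action_hom: "\<gamma> \<in> carrier M \<Longrightarrow> \<rho> \<gamma> \<in> hom G G"
  and action_cont: "\<gamma> \<in> carrier M \<Longrightarrow> continuous_on UNIV (\<rho> \<gamma>)"
  and action_mult: "\<gamma> \<in> carrier M \<Longrightarrow> \<delta> \<in> carrier M \<Longrightarrow> \<rho> (\<gamma> \<otimes>\<^bsub>M\<^esub> \<delta>) g = \<rho> \<gamma> (\<rho> \<delta> g)"
  and action_monoid: "monoid M"
  using action by (auto simp: endo_action_def)

lemma D_linear: "\<gamma> \<in> carrier M \<Longrightarrow> linear (D \<gamma>)"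
  unfolding D_def by (intro hom_derivative_approx action_hom action_cont)

lemma D_approx:
  assumes "\<gamma> \<in> carrier M" "\<epsilon> > 0"
  obtains \<delta> where "\<delta> > 0" "\<And>a. a \<in> B \<delta> \<Longrightarrow> \<rho> \<gamma> a \<in> U"
    "\<And>a. a \<in> B \<delta> \<Longrightarrow> norm (\<kappa> (\<rho> \<gamma> a) - D \<gamma> (\<kappa> a)) \<le> \<epsilon> * norm (\<kappa> a)"
  using hom_derivative_approx(2)[OF action_hom[OF assms(1)] action_cont[OF assms(1)] assms(2)]
  unfolding D_def by blast

text \<open>Compactness reduces the expansion to finitely many \<open>\<gamma>\<close>. Finiteness
  matters because each \<open>\<gamma>\<close> has its own radius on which \<open>D \<gamma>\<close>
  approximates \<open>\<rho> \<gamma>\<close>, and a common one is required.\<close>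

lemma expansive_if_orbits_unbounded:
  assumes unb: "\<And>v. v \<noteq> 0 \<Longrightarrow> \<not> bounded {D \<gamma> v | \<gamma>. \<gamma> \<in> carrier M}"
  shows "expansive G M \<rho>"
proof -
  have "\<exists>\<gamma>\<in>carrier M. norm (D \<gamma> v) > 2" if "v \<in> sphere 0 1" for v
  proof (rule ccontr)
    assume "\<not> ?thesis"
    then have "bounded {D \<gamma> v | \<gamma>. \<gamma> \<in> carrier M}" by (intro boundedI[of _ 2]) force
    moreover have "v \<noteq> 0" using that by auto
    ultimately show False using unb by blast
  qed
  then have cover: "sphere 0 1 \<subseteq> (\<Union>\<gamma>\<in>carrier M. {v. norm (D \<gamma> v) > 2})" by blast
  have "open {v. norm (D \<gamma> v) > 2}" if "\<gamma> \<in> carrier M" for \<gamma>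
    using D_linear[OF that]
    by (intro open_Collect_less continuous_intros linear_continuous_on)
      (simp add: linear_conv_bounded_linear)
  then obtain F where F: "F \<subseteq> carrier M" "finite F" "sphere 0 1 \<subseteq> (\<Union>\<gamma>\<in>F. {v. norm (D \<gamma> v) > 2})"
    using compactE_image[OF compact_sphere _ cover] by metis
  have expand: "\<exists>\<gamma>\<in>F. norm (D \<gamma> v) \<ge> 2 * norm v" if v: "v \<noteq> 0" for v
  proof -
    have "(1 / norm v) *\<^sub>R v \<in> sphere 0 1" using v by simp
    then obtain \<gamma> where \<gamma>: "\<gamma> \<in> F" "norm (D \<gamma> ((1 / norm v) *\<^sub>R v)) > 2" using F(3) by blast
    then have "norm (D \<gamma> v) / norm v > 2"
      using linear_scale[OF D_linear, of \<gamma> "1 / norm v" v] F(1) by auto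
    then show ?thesis using \<gamma>(1) v by (intro bexI[of _ \<gamma>]) (auto simp: field_simps)
  qed
  \<comment> \<open>Against a linear expansion by 2, an error of \<open>1/2\<close> still leaves
    expansion by \<open>3/2\<close>.\<close>
  have "\<exists>\<delta>>0. \<forall>a\<in>B \<delta>. norm (\<kappa> (\<rho> \<gamma> a) - D \<gamma> (\<kappa> a)) \<le> (1/2) * norm (\<kappa> a)" if "\<gamma> \<in> F" for \<gamma>
    using D_approx[of \<gamma> "1/2"] F(1) that by (metis half_gt_zero_iff subsetD zero_less_one)
  then obtain d where d: "\<And>\<gamma>. \<gamma> \<in> F \<Longrightarrow> d \<gamma> > 0" "\<And>\<gamma> a. \<gamma> \<in> F \<Longrightarrow> a \<in> B (d \<gamma>) \<Longrightarrow>
      norm (\<kappa> (\<rho> \<gamma> a) - D \<gamma> (\<kappa> a)) \<le> (1/2) * norm (\<kappa> a)" by metis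
  define \<delta> where "\<delta> = Min (insert 1 (d ` F))"
  have \<delta>: "\<delta> > 0" "\<And>\<gamma>. \<gamma> \<in> F \<Longrightarrow> \<delta> \<le> d \<gamma>" using F(2) d(1) by (auto simp: \<delta>_def)
  have "g = \<one>" if g: "\<And>\<gamma>. \<gamma> \<in> carrier M \<Longrightarrow> \<rho> \<gamma> g \<in> B \<delta>" for g
  proof (rule ccontr)
    assume "g \<noteq> \<one>"
    have oneM: "\<one>\<^bsub>M\<^esub> \<in> carrier M" using action_monoid by (simp add: monoid.one_closed)
    have "g \<in> U" using g[OF oneM] by (simp add: \<rho>_id B_def)
    then have pos: "norm (\<kappa> g) > 0" using \<kappa>_eq_0 \<open>g \<noteq> \<one>\<close> by simp
    \<comment> \<open>In the induction step \<open>\<gamma>'\<close> depends on the point reached so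
      far, and it is multiplied on the left because \<open>\<rho> \<gamma>\<close> acts first. The
      whole orbit of \<open>g\<close> lies in \<open>B \<delta>\<close>, so the estimate is
      available again at each stage.\<close>
    have grow: "\<exists>\<gamma>\<in>carrier M. norm (\<kappa> (\<rho> \<gamma> g)) \<ge> (3/2)^n * norm (\<kappa> g)" for n
    proof (induction n)
      case 0 show ?case using oneM by (intro bexI[of _ "\<one>\<^bsub>M\<^esub>"]) (simp_all add: \<rho>_id)
    next
      case (Suc n)
      then obtain \<gamma> where \<gamma>: "\<gamma> \<in> carrier M" "norm (\<kappa> (\<rho> \<gamma> g)) \<ge> (3/2)^n * norm (\<kappa> g)" by blast
      define a where "a = \<rho> \<gamma> g"
      have "0 < (3/2)^n * norm (\<kappa> g)" using pos by simp
      then have "norm (\<kappa> a) > 0" unfolding a_def using \<gamma>(2) by (rule less_le_trans)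
      then obtain \<gamma>' where \<gamma>': "\<gamma>' \<in> F" "norm (D \<gamma>' (\<kappa> a)) \<ge> 2 * norm (\<kappa> a)"
        using expand[of "\<kappa> a"] by auto
      have "a \<in> B (d \<gamma>')" using g[OF \<gamma>(1)] \<delta>(2)[OF \<gamma>'(1)] B_mono by (simp add: a_def)
      then have "norm (\<kappa> (\<rho> \<gamma>' a) - D \<gamma>' (\<kappa> a)) \<le> (1/2) * norm (\<kappa> a)" by (rule d(2)[OF \<gamma>'(1)])
      then have "3/2 * norm (\<kappa> a) \<le> norm (\<kappa> (\<rho> \<gamma>' a))"
        using \<gamma>'(2) norm_triangle_sub[of "D \<gamma>' (\<kappa> a)" "\<kappa> (\<rho> \<gamma>' a)"]
        unfolding norm_minus_commute[of "\<kappa> (\<rho> \<gamma>' a)"] by linarith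
      then have "(3/2)^Suc n * norm (\<kappa> g) \<le> norm (\<kappa> (\<rho> \<gamma>' a))"
        using \<gamma>(2) by (simp add: a_def)
      moreover have "\<rho> (\<gamma>' \<otimes>\<^bsub>M\<^esub> \<gamma>) g = \<rho> \<gamma>' a"
        using action_mult \<gamma>(1) \<gamma>'(1) F(1) by (auto simp: a_def)
      moreover have "\<gamma>' \<otimes>\<^bsub>M\<^esub> \<gamma> \<in> carrier M"
        using action_monoid \<gamma>(1) \<gamma>'(1) F(1) by (auto intro: monoid.m_closed)
      ultimately show ?case by metis
    qed
    obtain n where "\<delta> / norm (\<kappa> g) < (3/2)^n" using real_arch_pow[of "3/2"] by auto
    then have "\<delta> < (3/2)^n * norm (\<kappa> g)" using pos by (simp add: field_simps)
    moreover obtain \<gamma> where "\<gamma> \<in> carrier M" "norm (\<kappa> (\<rho> \<gamma> g)) \<ge> (3/2)^n * norm (\<kappa> g)"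
      using grow by blast
    ultimately show False using g[of \<gamma>] by (auto simp: B_def)
  qed
  moreover have "\<rho> \<gamma> \<one> = \<one>" if "\<gamma> \<in> carrier M" for \<gamma>
    using f_one[OF action_hom action_cont] that by blast
  ultimately have "(\<Inter>\<gamma>\<in>carrier M. \<rho> \<gamma> -` B \<delta>) = {\<one>}" using one_B[OF \<delta>(1)] by auto
  then show ?thesis unfolding expansive_def using open_B one_B[OF \<delta>(1)] by blast
qed

text \<open>The point \<open>g\<close> plays the role of the exponential of
  \<open>t *\<^sub>R v\<close>. Its orbit is controlled because \<open>\<rho> \<gamma>\<close>
  commutes with powers: for large \<open>n\<close>, \<open>\<rho> \<gamma> (b n)\<close> is the
  power with exponent \<open>2^n\<close> of an element whose coordinates have norm at most
  \<open>t * (K + 1) / 2^n\<close>.\<close>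

lemma not_expansive_if_bounded_orbit:
  assumes v: "v \<noteq> 0" and bdd: "bounded {D \<gamma> v | \<gamma>. \<gamma> \<in> carrier M}"
  shows "\<not> expansive G M \<rho>"
proof
  assume "expansive G M \<rho>"
  then obtain W where W: "open W" "\<one> \<in> W" "(\<Inter>\<gamma>\<in>carrier M. \<rho> \<gamma> -` W) = {\<one>}"
    unfolding expansive_def by blast
  obtain w where w: "w > 0" "B w \<subseteq> W" using B_subset W by metis
  obtain K where K: "K > 0" "\<And>\<gamma>. \<gamma> \<in> carrier M \<Longrightarrow> norm (D \<gamma> v) \<le> K"
    using bdd unfolding bounded_pos by blast
  obtain p where p: "p > 0"
    "\<And>a n. a \<in> U \<Longrightarrow> 2 * real n * norm (\<kappa> a) < p \<Longrightarrow> a [^] n \<in> U"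
    "\<And>a n. a \<in> U \<Longrightarrow> 2 * real n * norm (\<kappa> a) < p \<Longrightarrow>
       norm (\<kappa> (a [^] n) - real n *\<^sub>R \<kappa> a) \<le> 1/2 * (real n * norm (\<kappa> a))"
    "\<And>a n. a \<in> U \<Longrightarrow> 2 * real n * norm (\<kappa> a) < p \<Longrightarrow> norm (\<kappa> (a [^] n)) \<le> 2 * real n * norm (\<kappa> a)"
    by (rule pow_approx[of "1/2"]) auto
  obtain r where r: "r > 0" "\<And>x. norm x < r \<Longrightarrow> \<psi> x \<in> U" "\<And>x. norm x < r \<Longrightarrow> \<kappa> (\<psi> x) = x"
    "\<And>x. norm x < r \<Longrightarrow> isCont \<psi> x"
    by (rule \<psi>_near) auto
  define q where "q = Min {p, r, w}"
  have "q > 0" using p(1) r(1) w(1) by (simp add: q_def)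
  moreover have "q \<le> p" "q \<le> r" "q \<le> w" unfolding q_def by (rule Min_le; simp)+
  ultimately have q: "q > 0" "q \<le> p" "q \<le> r" "q \<le> w" .
  \<comment> \<open>Both \<open>t * norm v\<close> and \<open>t * (K + 1)\<close> must be small: the
    first controls the powers of \<open>a n\<close>, the second those of its images under the
    action.\<close>
  define N where "N = K + 1 + norm v"
  have N: "N > 0" "norm v \<le> N" "K + 1 \<le> N" using K(1) by (auto simp: N_def add_pos_nonneg)
  define t where "t = q / (4 * N)"
  have t: "t > 0" "2 * (t * N) < q" using N q by (auto simp: t_def)
  have tv: "2 * (t * norm v) < q" using mult_left_mono[OF N(2), of t] t by linarith
  have tK: "2 * (t * (K + 1)) < q" using mult_left_mono[OF N(3), of t] t by linarith
  define u where "u n = (t / 2^n) *\<^sub>R v" for n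
  have norm_u: "2^n * norm (u n) = t * norm v" for n using t(1) by (simp add: u_def)
  have norm_u': "norm (u n) \<le> t * norm v" for n
    unfolding norm_u[of n, symmetric] by (simp add: mult_le_cancel_right1)
  define a where "a n = \<psi> (u n)" for n
  have small_u: "norm (u n) < r" for n
  proof -
    have "t * norm v \<ge> 0" using t(1) by simp
    then show ?thesis using norm_u'[of n] tv q by linarith
  qed
  have a: "a n \<in> U" "\<kappa> (a n) = u n" for n
    using r(2,3)[OF small_u] by (simp_all add: a_def)
  define b where "b n = a n [^] (2^n :: nat)" for n
  have pw: "2 * real (2^n) * norm (\<kappa> (a n)) < p" for n
    using norm_u[of n] tv q by (simp add: a(2))
  \<comment> \<open>The error \<open>1/2\<close> in the choice of \<open>p\<close> keeps all
    \<open>\<kappa> (b n)\<close>, and hence their limit points, away from 0; this is what makes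
    \<open>g\<close> non-trivial.\<close>
  have b: "b n \<in> U" "norm (\<kappa> (b n) - t *\<^sub>R v) \<le> t * norm v / 2" for n
  proof -
    show "b n \<in> U" unfolding b_def by (rule p(2)[OF a(1) pw])
    have "real (2^n) *\<^sub>R u n = t *\<^sub>R v" by (simp add: u_def)
    then show "norm (\<kappa> (b n) - t *\<^sub>R v) \<le> t * norm v / 2"
      using p(3)[OF a(1) pw, of n] norm_u[of n] by (simp add: b_def a(2))
  qed
  have "seq_compact (cball (t *\<^sub>R v) (t * norm v / 2))" by (simp add: compact_imp_seq_compact)
  moreover have "\<forall>n. \<kappa> (b n) \<in> cball (t *\<^sub>R v) (t * norm v / 2)"
    using b(2) by (simp add: dist_norm norm_minus_commute)
  ultimately obtain y s where y: "y \<in> cball (t *\<^sub>R v) (t * norm v / 2)" "strict_mono (s :: nat \<Rightarrow> nat)"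
    and "((\<lambda>n. \<kappa> (b n)) \<circ> s) \<longlonglongrightarrow> y" by (rule seq_compactE)
  then have lim_y: "(\<lambda>n. \<kappa> (b (s n))) \<longlonglongrightarrow> y" by (simp add: o_def)
  have ny: "norm (y - t *\<^sub>R v) \<le> t * norm v / 2" using y(1) by (simp add: dist_norm norm_minus_commute)
  have tvpos: "t * norm v > 0" using t(1) v by simp
  have "y \<noteq> 0"
  proof
    assume "y = 0"
    then have "t * norm v \<le> t * norm v / 2" using ny t(1) by simp
    then show False using tvpos by simp
  qed
  have y_small: "norm y < r"
    using norm_triangle_sub[of y "t *\<^sub>R v"] ny tv q t(1) tvpos by simp
  define g where "g = \<psi> y"
  have g: "g \<noteq> \<one>" using \<open>y \<noteq> 0\<close> r(3)[OF y_small] \<kappa>_one by (auto simp: g_def)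
  have "(\<lambda>n. \<psi> (\<kappa> (b (s n)))) \<longlonglongrightarrow> \<psi> y" by (rule isCont_tendsto_compose[OF r(4)[OF y_small] lim_y])
  then have lim: "(\<lambda>n. b (s n)) \<longlonglongrightarrow> g" using \<psi>_\<kappa> b(1) by (simp add: g_def)
  \<comment> \<open>\<open>R\<close> bounds the coordinates of \<open>\<rho> \<gamma> (b n)\<close>
    for large \<open>n\<close>; how large depends on \<open>\<gamma>\<close>, but \<open>R\<close>
    does not. The image of the ball is compact, hence closed, so the limit
    \<open>\<rho> \<gamma> g\<close> stays in it.\<close>
  define R where "R = 2 * (t * (K + 1))"
  have R: "R < r" "R < w" "R < p" using tK q by (auto simp: R_def)
  have "continuous_on (cball 0 R) \<psi>"
    using r(4) R by (intro continuous_at_imp_continuous_on) auto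
  then have closed: "closed (\<psi> ` cball 0 R)"
    by (intro compact_imp_closed compact_continuous_image) auto
  have "\<rho> \<gamma> g \<in> W" if \<gamma>: "\<gamma> \<in> carrier M" for \<gamma>
  proof -
    \<comment> \<open>With this error the deviation at \<open>u n\<close> is at most
      \<open>t / 2^n\<close>, which accounts for the 1 in \<open>K + 1\<close>.\<close>
    have e: "1 / norm v > 0" using v by simp
    obtain \<delta> where \<delta>: "\<delta> > 0" "\<And>a. a \<in> B \<delta> \<Longrightarrow> \<rho> \<gamma> a \<in> U"
      "\<And>a. a \<in> B \<delta> \<Longrightarrow> norm (\<kappa> (\<rho> \<gamma> a) - D \<gamma> (\<kappa> a)) \<le> 1 / norm v * norm (\<kappa> a)"
      using D_approx[OF \<gamma> e] by blast
    have "(\<lambda>n. (t * (1/2)^n) *\<^sub>R v) \<longlonglongrightarrow> (t * 0) *\<^sub>R v"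
      by (intro tendsto_intros LIMSEQ_realpow_zero) auto
    then have "u \<longlonglongrightarrow> 0" by (simp add: u_def[abs_def] power_one_over)
    then have "\<forall>\<^sub>F n in sequentially. norm (u n) < \<delta>"
      using \<delta>(1) by (auto simp: tendsto_iff dist_norm)
    then have ev: "\<forall>\<^sub>F n in sequentially. \<rho> \<gamma> (b n) \<in> \<psi> ` cball 0 R"
    proof eventually_elim
      case (elim n)
      then have aB: "a n \<in> B \<delta>" using a by (simp add: B_def)
      have "D \<gamma> (u n) = (t / 2^n) *\<^sub>R D \<gamma> v"
        unfolding u_def by (rule linear_scale[OF D_linear[OF \<gamma>]])
      then have "norm (D \<gamma> (u n)) \<le> t / 2^n * K"
        using mult_left_mono[OF K(2)[OF \<gamma>], of "t / 2^n"] t(1) by simp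
      moreover have "1 / norm v * norm (u n) = t / 2^n" using v t(1) by (simp add: u_def)
      then have "norm (\<kappa> (\<rho> \<gamma> (a n)) - D \<gamma> (u n)) \<le> t / 2^n" using \<delta>(3)[OF aB] a(2) by simp
      ultimately have "norm (\<kappa> (\<rho> \<gamma> (a n))) \<le> t / 2^n * K + t / 2^n"
        using norm_triangle_sub[of "\<kappa> (\<rho> \<gamma> (a n))" "D \<gamma> (u n)"] by linarith
      then have "2 * 2^n * norm (\<kappa> (\<rho> \<gamma> (a n))) \<le> 2 * 2^n * (t / 2^n * K + t / 2^n)"
        by (intro mult_left_mono) auto
      also have "\<dots> = R" by (simp add: R_def algebra_simps)
      finally have le: "2 * real (2^n) * norm (\<kappa> (\<rho> \<gamma> (a n))) \<le> R" by simp
      have eq: "\<rho> \<gamma> (b n) = \<rho> \<gamma> (a n) [^] (2^n :: nat)"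
        unfolding b_def by (rule f_pow[OF action_hom[OF \<gamma>] action_cont[OF \<gamma>]])
      have "\<rho> \<gamma> (b n) \<in> U" "norm (\<kappa> (\<rho> \<gamma> (b n))) \<le> R"
        unfolding eq using p(2,4)[OF \<delta>(2)[OF aB], of "2^n"] le R(3) by linarith+
      then show ?case using \<psi>_\<kappa> by (intro image_eqI[of _ _ "\<kappa> (\<rho> \<gamma> (b n))"]) auto
    qed
    have "(\<lambda>n. \<rho> \<gamma> (b (s n))) \<longlonglongrightarrow> \<rho> \<gamma> g"
      by (rule continuous_on_tendsto_compose[OF action_cont[OF \<gamma>] lim]) auto
    then have "\<rho> \<gamma> g \<in> \<psi> ` cball 0 R"
      using closed eventually_subseq[OF y(2) ev] by (intro Lim_in_closed_set) auto
    then show ?thesis using r(2,3) R w(2) by (auto simp: B_def)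
  qed
  then have "g \<in> (\<Inter>\<gamma>\<in>carrier M. \<rho> \<gamma> -` W)" by blast
  then show False using W(3) g by blast
qed

lemma expansive_iff:
  "expansive G M \<rho> \<longleftrightarrow> (\<forall>v. v \<noteq> 0 \<longrightarrow> \<not> bounded {D \<gamma> v | \<gamma>. \<gamma> \<in> carrier M})"
  using expansive_if_orbits_unbounded not_expansive_if_bounded_orbit by blast

end

end

section \<open>From the smooth atlas to a strict chart\<close>

text \<open>As \<open>m (p, y) = y\<close> near \<open>p\<close>, the derivative of
  \<open>m (x, y) - y\<close> in \<open>y\<close> vanishes at \<open>(p, p)\<close> and is small
  nearby. The mean value inequality between \<open>p\<close> and \<open>y\<close>, together with
  \<open>m (x, p) = x\<close>, gives an error proportional to \<open>norm (y - p)\<close>, uniformly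
  in \<open>x\<close>.\<close>

lemma smooth_unital_operation_strict:
  fixes m :: "'v::euclidean_space \<times> 'v \<Rightarrow> 'v"
  assumes smooth: "smooth_on S m" and S: "(p, p) \<in> S"
    and unit_left: "\<And>y. (p, y) \<in> S \<Longrightarrow> m (p, y) = y"
    and unit_right: "\<And>x. (x, p) \<in> S \<Longrightarrow> m (x, p) = x"
    and \<epsilon>: "\<epsilon> > 0"
  shows "\<exists>\<delta>>0. \<forall>x y. norm (x - p) < \<delta> \<longrightarrow> norm (y - p) < \<delta> \<longrightarrow>
    (x, y) \<in> S \<and> norm (m (x, y) - x - (y - p)) \<le> \<epsilon> * norm (y - p)"
proof -
  have "open S" and dd: "\<And>vs. iter_dd vs m differentiable_on S"
    using smooth by (auto simp: smooth_on_def)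
  define D where "D q = frechet_derivative m (at q)" for q
  have D: "(m has_derivative D q) (at q)" if "q \<in> S" for q
    using dd[of "[]"] that \<open>open S\<close> unfolding D_def
    by (simp add: differentiable_on_eq_differentiable_at frechet_derivative_works)
  \<comment> \<open>Continuity of the first derivative comes from differentiability of
    \<open>iter_dd [w] m\<close>, one direction \<open>w\<close> at a time.\<close>
  have cont: "continuous_on S (\<lambda>q. D q w)" for w
    using differentiable_imp_continuous_on[OF dd[of "[w]"]] by (simp add: D_def)
  obtain \<delta>0 where \<delta>0: "\<delta>0 > 0" "ball (p, p) \<delta>0 \<subseteq> S" using \<open>open S\<close> S openE by blast
  have D_snd: "D (p, p) (0, w) = w" for w
  proof -
    have "((\<lambda>y. m (p, y)) has_derivative (\<lambda>w. D (p, p) (0, w))) (at p)"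
      by (rule has_derivative_compose[OF has_derivative_Pair[OF has_derivative_const has_derivative_ident] D[OF S]])
    moreover have "((\<lambda>y. m (p, y)) has_derivative (\<lambda>w. w)) (at p)"
    proof (rule has_derivative_transform_within_open[OF has_derivative_ident])
      show "open (ball p \<delta>0)" "p \<in> ball p \<delta>0" using \<delta>0(1) by auto
      show "y = m (p, y)" if "y \<in> ball p \<delta>0" for y
        using unit_left \<delta>0(2) that by (auto simp: dist_Pair_Pair subset_iff)
    qed
    ultimately show ?thesis by (metis has_derivative_unique)
  qed
  \<comment> \<open>Continuity in each fixed direction is used on the finitely many basis vectors;
    dividing by the dimension compensates for summing over them.\<close>
  define \<eta> where "\<eta> = \<epsilon> / real DIM('v)"
  have \<eta>: "\<eta> > 0" using \<epsilon> by (simp add: \<eta>_def)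
  have "\<forall>\<^sub>F q in at (p, p). norm (D q (0, i) - i) < \<eta>" for i
  proof -
    have "(\<lambda>q. D q (0, i)) \<midarrow>(p, p)\<rightarrow> i"
      using cont S \<open>open S\<close> D_snd by (metis continuous_on_eq_continuous_at isCont_def)
    then show ?thesis using \<eta> by (auto simp: tendsto_iff dist_norm)
  qed
  then have "\<forall>\<^sub>F q in at (p, p). \<forall>i\<in>(Basis :: 'v set). norm (D q (0, i) - i) < \<eta>"
    by (simp add: eventually_ball_finite)
  then obtain \<delta>1 where "\<delta>1 > 0" and away:
    "\<And>q i. q \<noteq> (p, p) \<Longrightarrow> dist q (p, p) < \<delta>1 \<Longrightarrow> i \<in> (Basis :: 'v set) \<Longrightarrow> norm (D q (0, i) - i) < \<eta>"
    unfolding eventually_at by blast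
  \<comment> \<open>The filter \<open>at (p, p)\<close> omits the point itself, where the difference
    is 0 by \<open>D_snd\<close>.\<close>
  then have \<delta>1: "\<delta>1 > 0"
    "\<And>q i. dist q (p, p) < \<delta>1 \<Longrightarrow> i \<in> (Basis :: 'v set) \<Longrightarrow> norm (D q (0, i) - i) < \<eta>"
    using D_snd \<eta> by (metis, metis diff_self norm_zero)
  define \<delta> where "\<delta> = min \<delta>0 \<delta>1 / 2"
  have \<delta>: "\<delta> > 0" using \<delta>0(1) \<delta>1(1) by (simp add: \<delta>_def)
  have near: "(x, y) \<in> S" "dist (x, y) (p, p) < \<delta>1"
    if "norm (x - p) < \<delta>" "norm (y - p) < \<delta>" for x y
  proof -
    have "dist (x, y) (p, p) \<le> norm (x - p) + norm (y - p)"
      using norm_Pair_le[of "x - p" "y - p"] by (simp add: dist_norm)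
    then have "dist (x, y) (p, p) < min \<delta>0 \<delta>1" using that unfolding \<delta>_def by linarith
    then show "(x, y) \<in> S" "dist (x, y) (p, p) < \<delta>1"
      using \<delta>0(2) by (auto simp: dist_commute)
  qed
  have D_near: "norm (D (x, y) (0, w) - w) \<le> \<epsilon> * norm w"
    if xy: "norm (x - p) < \<delta>" "norm (y - p) < \<delta>" for x y w
  proof -
    have lin: "linear (\<lambda>w. D (x, y) (0, w) - w)"
    proof -
      have "linear (D (x, y))" using D[OF near(1)[OF xy]] has_derivative_linear by blast
      moreover have "linear (\<lambda>w::'v. (0::'v, w))" by (auto simp: linear_iff)
      ultimately have "linear (D (x, y) \<circ> (\<lambda>w. (0, w)))" by (rule linear_compose[rotated])
      then show ?thesis by (intro linear_compose_sub) (auto simp: o_def linear_iff)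
    qed
    have "D (x, y) (0, w) - w = (\<Sum>i\<in>Basis. (w \<bullet> i) *\<^sub>R (D (x, y) (0, i) - i))"
      using linear_sum[OF lin, of "\<lambda>i. (w \<bullet> i) *\<^sub>R i" Basis] linear_scale[OF lin]
      by (simp add: euclidean_representation)
    also have "norm \<dots> \<le> (\<Sum>i\<in>(Basis::'v set). norm w * \<eta>)"
    proof (rule sum_norm_le)
      fix i :: 'v assume i: "i \<in> Basis"
      have "norm (D (x, y) (0, i) - i) \<le> \<eta>" using \<delta>1(2)[OF near(2)[OF xy] i] by simp
      then show "norm ((w \<bullet> i) *\<^sub>R (D (x, y) (0, i) - i)) \<le> norm w * \<eta>"
        using Basis_le_norm[OF i, of w] by (simp add: mult_mono)
    qed
    also have "\<dots> = \<epsilon> * norm w" by (simp add: \<eta>_def)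
    finally show ?thesis .
  qed
  have "norm (m (x, y) - x - (y - p)) \<le> \<epsilon> * norm (y - p)"
    if xy: "norm (x - p) < \<delta>" "norm (y - p) < \<delta>" for x y
  proof -
    have "norm ((m (x, y) - y) - (m (x, p) - p)) \<le> \<epsilon> * norm (y - p)"
    proof (rule differentiable_bound[of "ball p \<delta>"])
      fix z assume "z \<in> ball p \<delta>"
      then have z: "norm (z - p) < \<delta>" by (simp add: dist_norm norm_minus_commute)
      have "((\<lambda>y. m (x, y)) has_derivative (\<lambda>w. D (x, z) (0, w))) (at z)"
        by (rule has_derivative_compose[OF has_derivative_Pair[OF has_derivative_const has_derivative_ident]
              D[OF near(1)[OF xy(1) z]]])
      then have "((\<lambda>y. m (x, y) - y) has_derivative (\<lambda>w. D (x, z) (0, w) - w)) (at z)"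
        by (intro derivative_intros)
      then show "((\<lambda>y. m (x, y) - y) has_derivative (\<lambda>w. D (x, z) (0, w) - w)) (at z within ball p \<delta>)"
        by (rule has_derivative_at_withinI)
      show "onorm (\<lambda>w. D (x, z) (0, w) - w) \<le> \<epsilon>"
        using D_near[OF xy(1) z] by (rule onorm_le)
    qed (use xy \<delta> in \<open>auto simp: dist_norm norm_minus_commute\<close>)
    moreover have "m (x, p) = x" using near(1)[OF xy(1), of p] \<delta> by (intro unit_right) simp
    ultimately show ?thesis by (simp add: algebra_simps)
  qed
  then show ?thesis using \<delta> near(1) by blast
qed

text \<open>Translation gives the identity the coordinate 0. Smoothness of multiplication is used
  with all three charts equal to \<open>(U, \<phi>)\<close>, on the set \<open>S\<close> of
  coordinate pairs whose product stays in \<open>U\<close>; the unit laws of \<open>m\<close> at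
  \<open>p\<close> are those of the group.\<close>

lemma lie_group_strict_chart:
  fixes G :: "'g::t2_space monoid" (structure)
  assumes lie: "lie_group G A" and chart: "(U, \<phi>) \<in> A" "\<one> \<in> U"
  shows "strict_chart G U (\<lambda>g. \<phi> g - \<phi> \<one>) (\<lambda>x. inv_into U \<phi> (x + \<phi> \<one>))"
proof -
  interpret group G using lie by (simp add: lie_group_def)
  have carrier [simp]: "g \<in> carrier G" for g using lie by (simp add: lie_group_def)
  define p where "p = \<phi> \<one>"
  define \<psi> where "\<psi> = inv_into U \<phi>"
  have U: "open U" "open (\<phi> ` U)" "homeomorphism U (\<phi> ` U) \<phi> \<psi>"
    using lie chart unfolding lie_group_def \<psi>_def by blast+
  have \<psi>\<phi>: "\<psi> (\<phi> g) = g" if "g \<in> U" for g using U(3) that by (simp add: homeomorphism_def)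
  have img: "(\<lambda>g. \<phi> g - p) ` U = (\<lambda>y. y - p) ` (\<phi> ` U)" by auto
  define S where "S = {q \<in> \<phi> ` U \<times> \<phi> ` U. \<psi> (fst q) \<otimes> \<psi> (snd q) \<in> U}"
  define m where "m q = \<phi> (\<psi> (fst q) \<otimes> \<psi> (snd q))" for q
  have "smooth_on S m"
    using lie chart(1) unfolding lie_group_def S_def m_def \<psi>_def by blast
  moreover have "(p, p) \<in> S" using chart(2) \<psi>\<phi>[OF chart(2)] by (auto simp: S_def p_def)
  moreover have "m (p, y) = y" if "(p, y) \<in> S" for y
    using that \<psi>\<phi> chart(2) by (auto simp: S_def m_def p_def)
  moreover have "m (x, p) = x" if "(x, p) \<in> S" for x
    using that \<psi>\<phi> chart(2) by (auto simp: S_def m_def p_def)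
  ultimately have *: "\<exists>\<delta>>0. \<forall>x y. norm (x - p) < \<delta> \<longrightarrow> norm (y - p) < \<delta> \<longrightarrow>
    (x, y) \<in> S \<and> norm (m (x, y) - x - (y - p)) \<le> \<epsilon> * norm (y - p)" if "\<epsilon> > 0" for \<epsilon>
    using smooth_unital_operation_strict that by blast
  have "strict_chart G U (\<lambda>g. \<phi> g - p) (\<lambda>x. \<psi> (x + p))"
  proof
    show "carrier G = UNIV" "continuous_on UNIV (\<lambda>p. fst p \<otimes> snd p)" "continuous_on UNIV (\<lambda>x. inv x)"
      using lie by (simp_all add: lie_group_def)
    show "open U" "\<one> \<in> U" "\<phi> \<one> - p = 0" using U chart by (simp_all add: p_def)
    show "open ((\<lambda>g. \<phi> g - p) ` U)" unfolding img by (rule open_translation_subtract[OF U(2)])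
    show "homeomorphism U ((\<lambda>g. \<phi> g - p) ` U) (\<lambda>g. \<phi> g - p) (\<lambda>x. \<psi> (x + p))"
    proof (rule homeomorphismI)
      show "continuous_on U (\<lambda>g. \<phi> g - p)"
        by (rule continuous_on_diff[OF homeomorphism_cont1[OF U(3)] continuous_on_const])
      show "continuous_on ((\<lambda>g. \<phi> g - p) ` U) (\<lambda>x. \<psi> (x + p))"
        by (rule continuous_on_compose2[OF homeomorphism_cont2[OF U(3)]])
          (auto intro: continuous_on_add)
    qed (auto simp: \<psi>\<phi>)
    fix \<epsilon> :: real assume "\<epsilon> > 0"
    then obtain \<delta> where \<delta>: "\<delta> > 0" "\<And>x y. norm (x - p) < \<delta> \<Longrightarrow> norm (y - p) < \<delta> \<Longrightarrow>
      (x, y) \<in> S \<and> norm (m (x, y) - x - (y - p)) \<le> \<epsilon> * norm (y - p)" using * by blast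
    show "\<exists>\<delta>>0. \<forall>a\<in>U. \<forall>b\<in>U. norm (\<phi> a - p) < \<delta> \<longrightarrow> norm (\<phi> b - p) < \<delta> \<longrightarrow>
      a \<otimes> b \<in> U \<and> norm (\<phi> (a \<otimes> b) - p - (\<phi> a - p) - (\<phi> b - p)) \<le> \<epsilon> * norm (\<phi> b - p)"
    proof (intro exI[of _ \<delta>] conjI ballI impI \<delta>(1))
      fix a b assume ab: "a \<in> U" "b \<in> U" "norm (\<phi> a - p) < \<delta>" "norm (\<phi> b - p) < \<delta>"
      note \<delta>(2)[OF ab(3,4)]
      then show "a \<otimes> b \<in> U" "norm (\<phi> (a \<otimes> b) - p - (\<phi> a - p) - (\<phi> b - p)) \<le> \<epsilon> * norm (\<phi> b - p)"
        using \<psi>\<phi>[OF ab(1)] \<psi>\<phi>[OF ab(2)] by (simp_all add: S_def m_def algebra_simps)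
    qed
  qed
  then show ?thesis by (simp add: p_def \<psi>_def)
qed

section \<open>Comparison with the differential in the original chart\<close>

text \<open>\<open>diff_at_id\<close> differentiates at \<open>\<phi> \<one>\<close>, whereas
  \<open>strict_chart\<close> works at 0. Differentiability identifies both expressions with the
  unique derivative, and translations do not change it.\<close>

lemma frechet_derivative_translate:
  fixes F :: "'a::euclidean_space \<Rightarrow> 'b::real_normed_vector"
  assumes "(\<lambda>x. F (x + p) - c) differentiable at 0"
  shows "frechet_derivative F (at p) = frechet_derivative (\<lambda>x. F (x + p) - c) (at 0)"
proof -
  let ?H = "\<lambda>x. F (x + p) - c"
  have "(?H has_derivative frechet_derivative ?H (at 0)) (at (p - p))"
    using assms by (simp add: frechet_derivative_works)
  moreover have "((\<lambda>y. y - p) has_derivative (\<lambda>w. w)) (at p)"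
    by (auto intro!: derivative_eq_intros)
  ultimately have "((\<lambda>y. ?H (y - p)) has_derivative frechet_derivative ?H (at 0)) (at p)"
    by (rule has_derivative_compose[rotated])
  from has_derivative_add[OF this has_derivative_const[of c]]
  have "(F has_derivative frechet_derivative ?H (at 0)) (at p)" by simp
  then show ?thesis by (metis frechet_derivative_at)
qed

theorem theoremA:
  fixes G :: "'g::{t2_space, second_countable_topology} monoid"
    and A :: "('g set \<times> ('g \<Rightarrow> 'v::euclidean_space)) set"
    and M :: "'m monoid"
    and \<rho> :: "'m \<Rightarrow> 'g \<Rightarrow> 'g"
    and U :: "'g set" and \<phi> :: "'g \<Rightarrow> 'v"
  assumes "lie_group G A"
    and "connected (UNIV :: 'g set)"
    and "endo_action G M \<rho>"
    and "\<rho> \<one>\<^bsub>M\<^esub> = id"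
    and "(U, \<phi>) \<in> A" and "\<one>\<^bsub>G\<^esub> \<in> U"
  shows "expansive G M \<rho> \<longleftrightarrow>
    (\<forall>v::'v. v \<noteq> 0 \<longrightarrow> \<not> bounded {diff_at_id G U \<phi> (\<rho> \<gamma>) v | \<gamma>. \<gamma> \<in> carrier M})"
proof -
  define p where "p = \<phi> \<one>\<^bsub>G\<^esub>"
  interpret strict_chart G U "\<lambda>g. \<phi> g - p" "\<lambda>x. inv_into U \<phi> (x + p)"
    unfolding p_def by (rule lie_group_strict_chart) fact+
  \<comment> \<open>\<open>hom_differentiable\<close> supplies the differentiability required for
    the translation, so \<open>expansive_iff\<close> speaks about the differentials of the
    statement.\<close>
  have diff: "diff_at_id G U \<phi> (\<rho> \<gamma>)
      = frechet_derivative ((\<lambda>g. \<phi> g - p) \<circ> \<rho> \<gamma> \<circ> (\<lambda>x. inv_into U \<phi> (x + p))) (at 0)"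
    if "\<gamma> \<in> carrier M" for \<gamma>
  proof -
    have "((\<lambda>g. \<phi> g - p) \<circ> \<rho> \<gamma> \<circ> (\<lambda>x. inv_into U \<phi> (x + p))) differentiable at 0"
      using assms(3) that by (intro hom_differentiable) (auto simp: endo_action_def)
    then show ?thesis
      using frechet_derivative_translate[of "\<phi> \<circ> \<rho> \<gamma> \<circ> inv_into U \<phi>" p p]
      by (simp add: diff_at_id_def o_def flip: p_def)
  qed
  have "{diff_at_id G U \<phi> (\<rho> \<gamma>) v | \<gamma>. \<gamma> \<in> carrier M} =
      {frechet_derivative ((\<lambda>g. \<phi> g - p) \<circ> \<rho> \<gamma> \<circ> (\<lambda>x. inv_into U \<phi> (x + p))) (at 0) v | \<gamma>.
        \<gamma> \<in> carrier M}" for v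
    by (force simp: diff)
  then show ?thesis using expansive_iff[OF assms(3,4)] by simp
qed

end
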